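(* Let $A$, $\mathcal H$, $\mathcal H_+$, the boundary triplet $(\Gamma_0,\Gamma_1,\mathfrak H)$ with trace $\mathrm T=[\Gamma_0,\Gamma_1]^\top$, the matrix $J$, the family of orthogonal projections $Q_t$ ($t\in[0,1]$) onto Lagrangian planes with its second order expansion at a fixed $t_0\in[0,1]$, the self-adjoint extensions $\mathcal A_t$ of $A$ with $\mathrm T(\operatorname{dom}(\mathcal A_t))=\operatorname{ran}(Q_t)$, and the resolvents $R_t(\zeta)=(\mathcal A_t-\zeta)^{-1}$ be as in the context. Suppose that $\zeta_0\in\mathbb C$, $\zeta_0\notin\operatorname{Spec}(\mathcal A_{t_0})$, and for $\varepsilon>0$ put $$\mathcal U_\varepsilon=\{(t,\zeta)\in[0,1]\times\mathbb C:\ |t-t_0|\le\varepsilon,\ |\zeta-\zeta_0|\le\varepsilon\}.$$ (1) There exists $\varepsilon>0$ such that if $(t,\zeta)\in\mathcal U_\varepsilon$ then $\zeta\notin\operatorname{Spec}(\mathcal A_t)$. (2) For $\varepsilon>0$ as in part (1) and $(t,\zeta)\in\mathcal U_\varepsilon$ one has $$(\mathrm T R_t(\zeta))^*(Q_t-Q_{t_0})JQ_{t_0}\mathrm T R_{t_0}(\zeta)\in\mathcal B(\mathcal H,\mathcal H_+).$$ (3) For $\varepsilon>0$ and $\zeta\in\mathbb C$ as in part (1) define $$\dot R_{t_0}(\zeta):=(\mathrm T R_{t_0}(\zeta))^*\dot Q_{t_0}J\,\mathrm T R_{t_0}(\zeta).$$ Then $\dot R_{t_0}(\zeta)\in\mathcal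 B(\mathcal H,\mathcal H_+)$. Moreover, as $t\to t_0$, the following expansion holds uniformly for $|\zeta-\zeta_0|<\varepsilon$: $$R_t(\zeta)=R_{t_0}(\zeta)+\dot R_{t_0}(\zeta)(t-t_0)+o(t-t_0)\quad\text{in }\mathcal B(\mathcal H,\mathcal H_+).$$ (4) For $\varepsilon>0$ as in part (1), as $t\to t_0$ the following expansion holds uniformly for $|\zeta-\zeta_0|<\varepsilon$: $$R_t(\zeta)=R_{t_0}(\zeta)+\dot R_{t_0}(\zeta)(t-t_0)+\tfrac12\ddot R_{t_0}(\zeta)(t-t_0)^2+o((t-t_0)^2)\quad\text{in }\mathcal B(\mathcal H),$$ where $\dot R_{t_0}(\zeta)$ is as in part (3) and $$\ddot R_{t_0}(\zeta):=(\mathrm T R_{t_0}(\zeta))^*\ddot Q_{t_0}J\,\mathrm T R_{t_0}(\zeta)+2(\mathrm T\dot R_{t_0}(\zeta))^*\dot Q_{t_0}J\,\mathrm T R_{t_0}(\zeta).$$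
   Context: Inner products are linear in the first argument. $\mathcal H$, $\mathfrak H$ are complex Hilbert spaces. $A$ is a densely defined symmetric operator in $\mathcal H$ with equal (possibly infinite) deficiency indices. $\mathcal H_+:=\operatorname{dom}(A^* )$ is equipped with the graph scalar product $\langle u,v\rangle_{\mathcal H_+}=\langle u,v\rangle_{\mathcal H}+\langle A^*u,A^*v\rangle_{\mathcal H}$. $\mathcal B(\cdot,\cdot)$ denotes bounded linear operators, and $\mathcal B(\mathcal H)=\mathcal B(\mathcal H,\mathcal H)$. Boundary triplet: $\mathrm T:=[\Gamma_0,\Gamma_1]^\top\in\mathcal B(\mathcal H_+,\mathfrak H\times\mathfrak H)$ is bounded, surjective, and satisfies $\langle A^*u,v\rangle_{\mathcal H}-\langle u,A^*v\rangle_{\mathcal H}=\langle\Gamma_1u,\Gamma_0v\rangle_{\mathfrak H}-\langle\Gamma_0u,\Gamma_1v\rangle_{\mathfrak H}$ for all $u,v\in\mathcal H_+$. Symplectic form on $\mathfrak H\times\mathfrak H$: $\omega((f_1,f_2)^\top,(g_1,g_2)^\top)=\langle f_2,g_1\rangle_{\mathfrak H}-\langle f_1,g_2\rangle_{\mathfrak H}=\langle J(f_1,f_2)^\top,(g_1,g_2)^\top\rangle_{\mathfrak H\times\mathfrak H}$, with $J=\begin{bmatrix}0&I_{\mathfrak H}\\-I_{\mathfrak H}&0\end{bmatrix}$. A subspace $\mathcal F\subset\mathfrak H\times\mathfrak H$ is Lagrangian if it equals its $\omega$-annihilator $\{f:\omega(f,g)=0\ \forall g\in\mathcal F\}$. For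 every Lagrangian $\mathcal F$, the restriction of $A^*$ to $\mathrm T^{-1}(\mathcal F)$ is a self-adjoint extension of $A$, and all self-adjoint extensions arise this way. Family: for $t\in[0,1]$, $Q_t\in\mathcal B(\mathfrak H\times\mathfrak H)$ is an orthogonal projection whose range is Lagrangian; $t_0\in[0,1]$ is fixed and, as $t\to t_0$ (in $[0,1]$), $Q_t=Q_{t_0}+\dot Q_{t_0}(t-t_0)+\frac12\ddot Q_{t_0}(t-t_0)^2+o((t-t_0)^2)$ in $\mathcal B(\mathfrak H\times\mathfrak H)$ with $\dot Q_{t_0},\ddot Q_{t_0}\in\mathcal B(\mathfrak H\times\mathfrak H)$. $\mathcal A_t$ is the self-adjoint extension of $A$ with $\mathrm T(\operatorname{dom}(\mathcal A_t))=\operatorname{ran}(Q_t)$, and $R_t(\zeta):=(\mathcal A_t-\zeta)^{-1}$ for $\zeta\notin\operatorname{Spec}(\mathcal A_t)$. Since $R_t(\zeta)\in\mathcal B(\mathcal H,\mathcal H_+)$, $\mathrm T R_t(\zeta)\in\mathcal B(\mathcal H,\mathfrak H\times\mathfrak H)$, and $(\mathrm T R_t(\zeta))^*\in\mathcal B(\mathfrak H\times\mathfrak H,\mathcal H)$ is the adjoint of that operator. Similarly $\mathrm T\dot R_{t_0}(\zeta)$ is regarded as an element of $\mathcal B(\mathcal H,\mathfrak H\times\mathfrak H)$, which makes sense by part (3) of the claim.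
   Formalization: In (3) and (4) the adjoints in the derivative formulas are taken at the conjugate of ζ, i.e. (T R(ζ̄))^* and (T Ṙ(ζ̄))^*; with ζ as printed the expansions fail at non-real ζ unless Ṙ = 0. Membership claims in (2), (3) are also proved as printed. *)

theory Defs
  imports "HOL-Analysis.Analysis" "HOL-Library.Landau_Symbols" "HOL-Library.Equipollence"
begin

section \<open>Complex Hilbert spaces\<close>

class complex_vector = real_vector +
  fixes scaleC :: "complex \<Rightarrow> 'a \<Rightarrow> 'a"  (infixr "*\<^sub>C" 75)
  assumes scaleC_add_right: "c *\<^sub>C (x + y) = c *\<^sub>C x + c *\<^sub>C y"
    and scaleC_add_left: "(c + d) *\<^sub>C x = c *\<^sub>C x + d *\<^sub>C x"
    and scaleC_scaleC: "c *\<^sub>C d *\<^sub>C x = (c * d) *\<^sub>C x"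
    and scaleR_scaleC: "r *\<^sub>R x = complex_of_real r *\<^sub>C x"

text \<open>The inner product is linear in the first argument. The real inner product, and with it the
  norm and the topology, are those induced by \<^const>\<open>Re\<close> of the complex inner product.\<close>

class complex_inner = complex_vector + real_inner +
  fixes cinner :: "'a \<Rightarrow> 'a \<Rightarrow> complex"
  assumes cinner_commute: "cinner x y = cnj (cinner y x)"
    and cinner_add_left: "cinner (x + y) z = cinner x z + cinner y z"
    and cinner_scaleC_left: "cinner (c *\<^sub>C x) y = c * cinner x y"
    and inner_eq_Re_cinner: "inner x y = Re (cinner x y)"

class complex_hilbert = complex_inner + complete_space

global_interpretation complex_vector: vector_space "scaleC :: complex \<Rightarrow> 'a \<Rightarrow> 'a::complex_vector"
proof
  show "1 *\<^sub>C x = x" for x :: 'a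
    using scaleR_scaleC[of 1 x] by simp
qed (simp_all add: scaleC_add_right scaleC_add_left scaleC_scaleC)

lemma cinner_self: "cinner x x = complex_of_real ((norm x)\<^sup>2)"
  for x :: "'a::complex_inner"
proof (rule complex_eqI)
  show "Re (cinner x x) = Re (complex_of_real ((norm x)\<^sup>2))"
    by (simp flip: inner_eq_Re_cinner add: power2_norm_eq_inner)
  show "Im (cinner x x) = Im (complex_of_real ((norm x)\<^sup>2))"
    using arg_cong[OF cinner_commute[of x x], of Im] by simp
qed

instantiation complex :: complex_hilbert
begin

definition "scaleC (c::complex) (z::complex) = c * z"

definition "cinner (z::complex) (w::complex) = z * cnj w"

instance
  by standard
    (auto simp: scaleC_complex_def cinner_complex_def algebra_simps scaleR_conv_of_real
      inner_complex_def)

end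

instantiation prod :: (complex_vector, complex_vector) complex_vector
begin

definition "scaleC c p = (c *\<^sub>C fst p, c *\<^sub>C snd p)"

instance
  by standard
    (auto simp: scaleC_prod_def scaleC_add_right scaleC_add_left scaleC_scaleC scaleR_prod_def
      scaleR_scaleC)

end

instantiation prod :: (complex_inner, complex_inner) complex_inner
begin

definition "cinner p q = cinner (fst p) (fst q) + cinner (snd p) (snd q)"

instance
proof
  fix p q :: "'a \<times> 'b"
  show "cinner p q = cnj (cinner q p)"
    using cinner_commute[of "fst p" "fst q"] cinner_commute[of "snd p" "snd q"]
    by (simp add: cinner_prod_def)
qed (auto simp: cinner_prod_def scaleC_prod_def cinner_add_left cinner_scaleC_left
      inner_prod_def inner_eq_Re_cinner algebra_simps)

end

instance prod :: (complex_hilbert, complex_hilbert) complex_hilbert ..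

section \<open>Bounded operators\<close>

definition bounded_clinear :: "('a::complex_inner \<Rightarrow> 'b::complex_inner) \<Rightarrow> bool" where
  "bounded_clinear F \<longleftrightarrow> bounded_linear F \<and> (\<forall>c x. F (c *\<^sub>C x) = c *\<^sub>C F x)"

definition hilbert_adjoint ::
    "('a::complex_inner \<Rightarrow> 'b::complex_inner) \<Rightarrow> 'b \<Rightarrow> 'a" where
  "hilbert_adjoint F = (THE G. \<forall>x y. cinner (F x) y = cinner x (G y))"

definition orthogonal_projection :: "('a::complex_inner \<Rightarrow> 'a) \<Rightarrow> bool" where
  "orthogonal_projection P \<longleftrightarrow>
     bounded_clinear P \<and> (\<forall>x. P (P x) = P x) \<and> (\<forall>x y. cinner (P x) y = cinner x (P y))"

definition orthonormal_basis :: "'a::complex_inner set \<Rightarrow> 'a set \<Rightarrow> bool" where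
  "orthonormal_basis B S \<longleftrightarrow>
     B \<subseteq> S \<and> (\<forall>b\<in>B. \<forall>b'\<in>B. cinner b b' = (if b = b' then 1 else 0)) \<and>
     (\<forall>x\<in>S. (\<forall>b\<in>B. cinner x b = 0) \<longrightarrow> x = 0)"

section \<open>Unbounded operators\<close>

text \<open>An unbounded operator is represented by its graph, so that its domain is the
  \<^const>\<open>Domain\<close> of the relation, equality of operators is equality of relations, and ``is an
  extension of'' is the superset relation.\<close>

definition linear_op :: "('a::complex_inner \<times> 'a) set \<Rightarrow> bool" where
  "linear_op S \<longleftrightarrow> complex_vector.subspace S \<and> single_valued S"

definition op_apply :: "('a \<times> 'a) set \<Rightarrow> 'a \<Rightarrow> 'a" where
  "op_apply S u = (THE v. (u, v) \<in> S)"

definition densely_defined :: "('a::complex_inner \<times> 'a) set \<Rightarrow> bool" where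
  "densely_defined S \<longleftrightarrow> closure (Domain S) = UNIV"

definition op_adjoint :: "('a::complex_inner \<times> 'a) set \<Rightarrow> ('a \<times> 'a) set" where
  "op_adjoint S = {(v, w). \<forall>(u, u')\<in>S. cinner u' v = cinner u w}"

definition symmetric_op :: "('a::complex_inner \<times> 'a) set \<Rightarrow> bool" where
  "symmetric_op S \<longleftrightarrow> linear_op S \<and> (\<forall>(u, u')\<in>S. \<forall>(v, v')\<in>S. cinner u' v = cinner u v')"

definition self_adjoint_op :: "('a::complex_inner \<times> 'a) set \<Rightarrow> bool" where
  "self_adjoint_op S \<longleftrightarrow> linear_op S \<and> densely_defined S \<and> op_adjoint S = S"

definition op_shift :: "('a::complex_inner \<times> 'a) set \<Rightarrow> complex \<Rightarrow> ('a \<times> 'a) set" where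
  "op_shift S \<zeta> = {(u, v - \<zeta> *\<^sub>C u) | u v. (u, v) \<in> S}"

definition resolvent :: "('a::complex_inner \<times> 'a) set \<Rightarrow> complex \<Rightarrow> 'a \<Rightarrow> 'a" where
  "resolvent S \<zeta> f = (THE u. (u, f) \<in> op_shift S \<zeta>)"

definition Spec :: "('a::complex_inner \<times> 'a) set \<Rightarrow> complex set" where
  "Spec S = {\<zeta>. \<not> ((\<forall>f. \<exists>!u. (u, f) \<in> op_shift S \<zeta>) \<and> bounded_clinear (resolvent S \<zeta>))}"

text \<open>The deficiency indices are the Hilbert space dimensions, i.e. the cardinalities of
  orthonormal bases, of the kernels of \<open>A\<^sup>* - \<i>\<close> and \<open>A\<^sup>* + \<i>\<close>.\<close>

definition deficiency_space :: "('a::complex_inner \<times> 'a) set \<Rightarrow> complex \<Rightarrow> 'a set" where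
  "deficiency_space A z = {u. (u, 0) \<in> op_shift (op_adjoint A) z}"

definition equal_deficiency_indices :: "('a::complex_inner \<times> 'a) set \<Rightarrow> bool" where
  "equal_deficiency_indices A \<longleftrightarrow>
     (\<exists>B C. orthonormal_basis B (deficiency_space A \<i>) \<and>
            orthonormal_basis C (deficiency_space A (- \<i>)) \<and> B \<approx> C)"

section \<open>The space of the adjoint domain with the graph scalar product\<close>

text \<open>Everything below takes the symmetric operator \<open>A\<close> as argument; the space
  \<open>H\<^sub>+\<close> is \<open>dom(A\<^sup>*)\<close>. Since this is a subset depending on \<open>A\<close> and not a type,
  bounded operators into it and their norms are introduced separately.\<close>

definition hplus :: "('a::complex_inner \<times> 'a) set \<Rightarrow> 'a set" where
  "hplus A = Domain (op_adjoint A)"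

definition hplus_cinner :: "('a::complex_inner \<times> 'a) set \<Rightarrow> 'a \<Rightarrow> 'a \<Rightarrow> complex" where
  "hplus_cinner A u v =
     cinner u v + cinner (op_apply (op_adjoint A) u) (op_apply (op_adjoint A) v)"

definition hplus_norm :: "('a::complex_inner \<times> 'a) set \<Rightarrow> 'a \<Rightarrow> real" where
  "hplus_norm A u = sqrt (Re (hplus_cinner A u u))"

definition bounded_into_hplus ::
    "('a::complex_inner \<times> 'a) set \<Rightarrow> ('a \<Rightarrow> 'a) \<Rightarrow> bool" where
  "bounded_into_hplus A F \<longleftrightarrow>
     (\<forall>x. F x \<in> hplus A) \<and> (\<forall>x y. F (x + y) = F x + F y) \<and> (\<forall>c x. F (c *\<^sub>C x) = c *\<^sub>C F x) \<and>
     (\<exists>K. \<forall>x. hplus_norm A (F x) \<le> K * norm x)"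

definition hplus_onorm :: "('a::complex_inner \<times> 'a) set \<Rightarrow> ('a \<Rightarrow> 'a) \<Rightarrow> real" where
  "hplus_onorm A F = (SUP x. hplus_norm A (F x) / norm x)"

section \<open>Boundary triplets and Lagrangian planes\<close>

definition trace_map :: "('a \<Rightarrow> 'k) \<Rightarrow> ('a \<Rightarrow> 'k) \<Rightarrow> 'a \<Rightarrow> 'k \<times> 'k" where
  "trace_map \<Gamma>0 \<Gamma>1 u = (\<Gamma>0 u, \<Gamma>1 u)"

text \<open>Values of \<open>\<Gamma>0\<close> and \<open>\<Gamma>1\<close> outside \<open>dom(A\<^sup>*)\<close> are irrelevant.\<close>

definition boundary_triplet ::
    "('a::complex_inner \<times> 'a) set \<Rightarrow> ('a \<Rightarrow> 'k::complex_inner) \<Rightarrow> ('a \<Rightarrow> 'k) \<Rightarrow> bool" where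
  "boundary_triplet A \<Gamma>0 \<Gamma>1 \<longleftrightarrow>
     (\<forall>u\<in>hplus A. \<forall>v\<in>hplus A.
        trace_map \<Gamma>0 \<Gamma>1 (u + v) = trace_map \<Gamma>0 \<Gamma>1 u + trace_map \<Gamma>0 \<Gamma>1 v) \<and>
     (\<forall>c. \<forall>u\<in>hplus A. trace_map \<Gamma>0 \<Gamma>1 (c *\<^sub>C u) = c *\<^sub>C trace_map \<Gamma>0 \<Gamma>1 u) \<and>
     (\<exists>K. \<forall>u\<in>hplus A. norm (trace_map \<Gamma>0 \<Gamma>1 u) \<le> K * hplus_norm A u) \<and>
     trace_map \<Gamma>0 \<Gamma>1 ` hplus A = UNIV \<and>
     (\<forall>u\<in>hplus A. \<forall>v\<in>hplus A.
        cinner (op_apply (op_adjoint A) u) v - cinner u (op_apply (op_adjoint A) v)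
        = cinner (\<Gamma>1 u) (\<Gamma>0 v) - cinner (\<Gamma>0 u) (\<Gamma>1 v))"

definition sympl_J :: "'k \<times> 'k \<Rightarrow> 'k \<times> 'k::complex_inner" where
  "sympl_J f = (snd f, - fst f)"

definition sympl_form :: "'k \<times> 'k \<Rightarrow> 'k \<times> 'k::complex_inner \<Rightarrow> complex" where
  "sympl_form f g = cinner (snd f) (fst g) - cinner (fst f) (snd g)"

lemma sympl_form_eq_cinner_J: "sympl_form f g = cinner (sympl_J f) g"
proof -
  have "cinner (- fst f) (snd g) = - cinner (fst f) (snd g)"
    using cinner_add_left[of "- fst f" "fst f" "snd g"] cinner_scaleC_left[of 0 "fst f" "snd g"]
    by (simp add: eq_neg_iff_add_eq_0)
  then show ?thesis
    by (simp add: sympl_form_def sympl_J_def cinner_prod_def)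
qed

definition lagrangian :: "('k \<times> 'k::complex_inner) set \<Rightarrow> bool" where
  "lagrangian F \<longleftrightarrow>
     complex_vector.subspace F \<and> F = {f. \<forall>g\<in>F. sympl_form f g = 0}"

section \<open>Derivatives of the resolvent\<close>

text \<open>In the next two definitions \<open>T\<close> is the trace, \<open>S\<close> the self-adjoint extension at the base
  point, and \<open>Q1\<close>, \<open>Q2\<close> the first and second derivative of the family of projections. The adjoints
  are taken at the conjugate spectral parameter, in accordance with the Krein formula
  \<open>R\<^sub>t(\<zeta>) - R\<^sub>s(\<zeta>) = (T R\<^sub>t(cnj \<zeta>))\<^sup>* (Q\<^sub>t - Q\<^sub>s) J Q\<^sub>s T R\<^sub>s(\<zeta>)\<close>. The source writes \<open>(T R\<^sub>t(cnj \<zeta>))\<^sup>*\<close> as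
  \<open>(T R\<^sub>t(\<zeta>))\<^sup>*\<close>. The two agree for real \<open>\<zeta>\<close>. For non-real \<open>\<zeta>\<close> the operator
  \<open>(T R\<^sub>t(\<zeta>))\<^sup>*\<close> has range in \<open>ker(A\<^sup>* - cnj \<zeta>)\<close>, whereas the difference of resolvents has range in
  \<open>ker(A\<^sup>* - \<zeta>)\<close>, so the expansions fail without the conjugation.\<close>

definition resolvent_dot ::
    "('h \<Rightarrow> 'k \<times> 'k) \<Rightarrow> ('h::complex_hilbert \<times> 'h) set \<Rightarrow>
     ('k \<times> 'k \<Rightarrow> 'k \<times> 'k::complex_hilbert) \<Rightarrow> complex \<Rightarrow> 'h \<Rightarrow> 'h" where
  "resolvent_dot T S Q1 \<zeta> f =
     hilbert_adjoint (\<lambda>g. T (resolvent S (cnj \<zeta>) g)) (Q1 (sympl_J (T (resolvent S \<zeta> f))))"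

definition resolvent_ddot ::
    "('h \<Rightarrow> 'k \<times> 'k) \<Rightarrow> ('h::complex_hilbert \<times> 'h) set \<Rightarrow> ('k \<times> 'k \<Rightarrow> 'k \<times> 'k) \<Rightarrow>
     ('k \<times> 'k \<Rightarrow> 'k \<times> 'k::complex_hilbert) \<Rightarrow> complex \<Rightarrow> 'h \<Rightarrow> 'h" where
  "resolvent_ddot T S Q1 Q2 \<zeta> f =
     hilbert_adjoint (\<lambda>g. T (resolvent S (cnj \<zeta>) g)) (Q2 (sympl_J (T (resolvent S \<zeta> f))))
     + 2 *\<^sub>R hilbert_adjoint (\<lambda>g. T (resolvent_dot T S Q1 (cnj \<zeta>) g))
         (Q1 (sympl_J (T (resolvent S \<zeta> f))))"

end

theory Submission
  imports Defs
begin

text \<open>All extensions are restrictions of \<open>A\<^sup>*\<close>, so two resolvents \<open>R\<close>, \<open>R0\<close> at the same \<open>\<zeta>\<close> differ by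
  a vector of \<open>ker (A\<^sup>* - \<zeta>)\<close>, and Green's identity computes it from boundary data alone. With
  \<open>a = J T R0(\<zeta>) f\<close> and \<open>b = T R(cnj \<zeta>) g\<close>, isotropy of the two planes gives the Krein formula
  (\<open>Krein_formula\<close>), in which the difference of the projections appears linearly:
  \<open>cinner (R f - R0 f) g = cinner (P a - P0 a) b\<close>.

  Uniform bounds on the resolvents come from lower bounds \<open>norm u \<le> M * norm (S u - \<zeta> u)\<close>. For
  self-adjoint \<open>S\<close> such a bound characterises the resolvent set, because it then holds at
  \<open>cnj \<zeta>\<close> as well, so that \<open>S - \<zeta>\<close> has closed and dense range (\<open>not_Spec_iff_bounded_below\<close>). If
  \<open>u\<close> lies in the domain of \<open>S\<close> and \<open>f = S u - \<zeta> u\<close>, then Green's identity also bounds \<open>u - R0 f\<close> by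
  \<open>norm (P - P0)\<close> times the graph norm of \<open>u\<close>. For close projections this is absorbed, and a
  lower bound passes from \<open>S0\<close> to \<open>S\<close> (\<open>bounded_below_at_near_extension\<close>). This shows that the
  resolvent set is stable, and compactness of the closed disc makes the bounds uniform in \<open>\<zeta>\<close>.

  For the expansions write \<open>b0\<close> and \<open>b1\<close> for the traces of the unperturbed resolvent and of its
  first derivative at \<open>cnj \<zeta>\<close>, applied to \<open>g\<close>, write \<open>s = t - t0\<close>, and let \<open>\<rho>\<close> be the second order
  remainder of the projections. Substituting the expansion of \<open>P - P0\<close> into the Krein formula,
  the second order remainder of the resolvent, paired with \<open>g\<close>, becomes
  \<open>cinner (\<rho> a) b + s * cinner (Qdot a) (b - b0 - s b1) + s\<^sup>2 / 2 * cinner (Qddot a) (b - b0)\<close>.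
  Here \<open>b - b0 - s b1\<close> is the trace of a first order remainder at \<open>cnj \<zeta>\<close>, hence of order
  \<open>s\<^sup>2\<close>, and \<open>b - b0\<close> is of order \<open>s\<close> (\<open>first_remainder_le\<close>, \<open>second_remainder_le\<close>).
  The first order remainder lies in \<open>ker (A\<^sup>* - \<zeta>)\<close>, where the graph norm is equivalent to the norm
  of the Hilbert space, which yields the stronger topology in the first order expansion.\<close>

section \<open>Complex inner products and the Riesz representation\<close>

lemma cinner_add_right: "cinner x (y + z) = cinner x y + cinner x z"
  for x :: "'a::complex_inner"
  by (metis cinner_add_left cinner_commute complex_cnj_add)

lemma cinner_scaleC_right: "cinner x (c *\<^sub>C y) = cnj c * cinner x y"
  for x :: "'a::complex_inner"
  by (metis cinner_commute cinner_scaleC_left complex_cnj_mult)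

lemma cinner_scaleR_left: "cinner (r *\<^sub>R x) y = of_real r * cinner x y"
  for x :: "'a::complex_inner"
  by (simp add: scaleR_scaleC cinner_scaleC_left)

lemma cinner_scaleR_right: "cinner x (r *\<^sub>R y) = of_real r * cinner x y"
  for x :: "'a::complex_inner"
  by (simp add: scaleR_scaleC cinner_scaleC_right)

lemma cinner_zero_left [simp]: "cinner 0 x = 0" for x :: "'a::complex_inner"
  using cinner_scaleR_left[of 0 0 x] by simp

lemma cinner_zero_right [simp]: "cinner x 0 = 0" for x :: "'a::complex_inner"
  using cinner_scaleR_right[of x 0 0] by simp

lemma cinner_minus_left: "cinner (- x) y = - cinner x y" for x :: "'a::complex_inner"
  using cinner_scaleR_left[of "-1" x y] by simp

lemma cinner_minus_right: "cinner x (- y) = - cinner x y" for x :: "'a::complex_inner"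
  using cinner_scaleR_right[of x "-1" y] by simp

lemma cinner_diff_left: "cinner (x - y) z = cinner x z - cinner y z" for x :: "'a::complex_inner"
  using cinner_add_left[of x "-y" z] by (simp add: cinner_minus_left)

lemma cinner_diff_right: "cinner x (y - z) = cinner x y - cinner x z" for x :: "'a::complex_inner"
  using cinner_add_right[of x y "-z"] by (simp add: cinner_minus_right)

lemmas cinner_simps = cinner_add_left cinner_add_right cinner_diff_left cinner_diff_right
  cinner_minus_left cinner_minus_right cinner_scaleC_left cinner_scaleC_right
  cinner_scaleR_left cinner_scaleR_right

lemma norm_scaleC: "norm (c *\<^sub>C x) = cmod c * norm x" for x :: "'a::complex_inner"
proof -
  have "complex_of_real ((norm (c *\<^sub>C x))\<^sup>2) = of_real ((cmod c * norm x)\<^sup>2)"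
    unfolding cinner_self[symmetric] cinner_scaleC_left cinner_scaleC_right power_mult_distrib
    using complex_norm_square[of c] by (simp add: cinner_self mult_ac)
  then have "(norm (c *\<^sub>C x))\<^sup>2 = (cmod c * norm x)\<^sup>2"
    using of_real_eq_iff by blast
  then show ?thesis
    by (simp add: power2_eq_iff_nonneg)
qed

lemma cinner_Cauchy_Schwarz: "cmod (cinner x y) \<le> norm x * norm y" for x :: "'a::complex_inner"
proof (cases "cinner x y = 0")
  case False
  \<comment> \<open>Rotating \<open>x\<close> by the phase \<open>c\<close> makes the inner product real, so that the real
    Cauchy--Schwarz inequality applies.\<close>
  define c where "c = cnj (sgn (cinner x y))"
  have "cmod c = 1"
    using False by (simp add: c_def norm_sgn)
  have "c * cinner x y = of_real (cmod (cinner x y))"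
    using False complex_norm_square[of "cinner x y"]
    by (simp add: c_def sgn_eq field_simps power2_eq_square)
  then have "cmod (cinner x y) = inner (c *\<^sub>C x) y"
    by (simp add: inner_eq_Re_cinner cinner_scaleC_left)
  also have "\<dots> \<le> norm (c *\<^sub>C x) * norm y"
    by (rule norm_cauchy_schwarz)
  finally show ?thesis
    by (simp add: norm_scaleC \<open>cmod c = 1\<close>)
qed simp

lemma norm_le_if_cinner_le:
  fixes x :: "'a::complex_inner"
  assumes "0 \<le> c" and "\<And>g. cmod (cinner x g) \<le> c * norm g"
  shows "norm x \<le> c"
proof (cases "x = 0")
  case False
  have "norm x * norm x \<le> c * norm x"
    using assms(2)[of x] by (simp add: cinner_self power2_eq_square norm_mult)
  then show ?thesis
    using False by simp
qed (use assms in simp)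

text \<open>The representing vector is the minimiser of \<open>(norm x)\<^sup>2 - 2 * \<phi> x\<close> over the subspace: a
  minimising sequence is Cauchy by the parallelogram identity, and at the minimiser the
  derivative of the quadratic functional vanishes in each direction of the subspace.\<close>

lemma Riesz_on_closed_subspace:
  fixes \<phi> :: "'a::{real_inner,complete_space} \<Rightarrow> real"
  assumes \<phi>: "bounded_linear \<phi>" and V: "closed V" "subspace V"
  shows "\<exists>y\<in>V. \<forall>x\<in>V. \<phi> x = inner x y"
proof -
  interpret \<phi>: bounded_linear \<phi> by (rule \<phi>)
  define q where "q x = (norm x)\<^sup>2 - 2 * \<phi> x" for x
  obtain K where K: "\<And>x. norm (\<phi> x) \<le> norm x * K"
    using \<phi>.bounded by blast
  have lower: "- (K\<^sup>2) \<le> q x" for x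
  proof -
    have "\<phi> x \<le> norm x * K"
      using K[of x] by simp
    moreover have "0 \<le> (norm x - K)\<^sup>2"
      by simp
    ultimately show ?thesis
      by (simp add: q_def power2_diff)
  qed
  have bdd: "bdd_below (q ` V)"
    using lower by (auto intro!: bdd_belowI2)
  have ne: "V \<noteq> {}"
    using V subspace_0 by auto
  define I where "I = Inf (q ` V)"
  have I: "I \<le> q x" if "x \<in> V" for x
    unfolding I_def using bdd that by (auto intro: cInf_lower)
  have "\<exists>x\<in>V. q x < I + 1 / Suc n" for n
  proof -
    have "Inf (q ` V) < I + 1 / Suc n"
      by (simp add: I_def)
    then show ?thesis
      using cInf_lessD[of "q ` V"] ne by blast
  qed
  then obtain u where uV: "\<And>n. u n \<in> V" and u: "\<And>n. q (u n) < I + 1 / Suc n"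
    by metis
  have parallelogram: "(norm (x - y))\<^sup>2 \<le> 2 * (q x + q y - 2 * I)" if "x \<in> V" "y \<in> V" for x y
  proof -
    have "(1/2) *\<^sub>R (x + y) \<in> V"
      using that V subspace_add subspace_scale by blast
    moreover have "(norm (x - y))\<^sup>2 = 2 * q x + 2 * q y - 4 * q ((1/2) *\<^sub>R (x + y))"
      by (simp add: q_def \<phi>.add \<phi>.scaleR power_divide)
        (simp add: power2_norm_eq_inner inner_add_left inner_add_right
          inner_diff_left inner_diff_right inner_commute field_simps)
    ultimately show ?thesis
      using I by fastforce
  qed
  have "Cauchy u"
  proof (rule metric_CauchyI)
    fix e :: real assume "0 < e"
    obtain N :: nat where N: "4 / e\<^sup>2 < N"
      using reals_Archimedean2 by blast
    show "\<exists>M. \<forall>m\<ge>M. \<forall>n\<ge>M. dist (u m) (u n) < e"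
    proof (intro exI allI impI)
      fix m n assume mn: "m \<ge> N" "n \<ge> N"
      have N0: "0 < real N"
        using N \<open>0 < e\<close> by (smt (verit) divide_pos_pos zero_less_power)
      have "1 / Suc m \<le> 1 / N" "1 / Suc n \<le> 1 / N"
        using mn N0 by (auto intro!: frac_le)
      then have "(norm (u m - u n))\<^sup>2 < 4 / N"
        using parallelogram[OF uV[of m] uV[of n]] u[of m] u[of n] by simp
      also have "\<dots> < e\<^sup>2"
        using N N0 \<open>0 < e\<close> by (simp add: field_simps)
      finally show "dist (u m) (u n) < e"
        using \<open>0 < e\<close> by (simp add: dist_norm power2_less_imp_less)
    qed
  qed
  then obtain y where y: "u \<longlonglongrightarrow> y"
    using Cauchy_convergent convergent_def by blast
  have "y \<in> V"
    using V(1) uV y closed_sequentially by blast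
  have "(\<lambda>n. q (u n)) \<longlonglongrightarrow> q y"
    unfolding q_def by (intro tendsto_intros \<phi>.tendsto y)
  moreover have "(\<lambda>n. I + 1 / Suc n) \<longlonglongrightarrow> I"
    using tendsto_add[OF tendsto_const[of I] LIMSEQ_inverse_real_of_nat]
    by (simp add: inverse_eq_divide)
  ultimately have "q y \<le> I"
    by (rule LIMSEQ_le) (use u less_imp_le in blast)
  then have min: "q y \<le> q x" if "x \<in> V" for x
    using I[OF that] by simp
  have "\<phi> x = inner x y" if "x \<in> V" for x
  proof (cases "x = 0")
    case False
    \<comment> \<open>The step \<open>s\<close> minimises the quadratic polynomial \<open>q (y + s *\<^sub>R x)\<close> in \<open>s\<close>.\<close>
    define s where "s = (\<phi> x - inner x y) / (norm x)\<^sup>2"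
    have nz: "(norm x)\<^sup>2 > 0"
      using False by simp
    have "y + s *\<^sub>R x \<in> V"
      using that \<open>y \<in> V\<close> V subspace_add subspace_scale by blast
    then have "q y \<le> q (y + s *\<^sub>R x)"
      by (rule min)
    also have "q (y + s *\<^sub>R x) = q y + s * (s * (norm x)\<^sup>2) - 2 * s * (\<phi> x - inner x y)"
      by (simp add: q_def \<phi>.add \<phi>.scaleR power2_norm_eq_inner inner_add_left inner_add_right
          inner_commute algebra_simps)
    also have "s * (norm x)\<^sup>2 = \<phi> x - inner x y"
      using nz by (simp add: s_def)
    finally have "s * (\<phi> x - inner x y) \<le> 0"
      by simp
    then have "(\<phi> x - inner x y)\<^sup>2 \<le> 0"
      using nz by (simp add: s_def divide_le_0_iff power2_eq_square)
    then show ?thesis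
      by simp
  qed (simp add: \<phi>.zero)
  with \<open>y \<in> V\<close> show ?thesis by blast
qed

section \<open>Bounded complex linear operators and their adjoints\<close>

lemma bounded_clinearI:
  fixes F :: "'a::complex_inner \<Rightarrow> 'b::complex_inner"
  assumes "\<And>x y. F (x + y) = F x + F y" "\<And>c x. F (c *\<^sub>C x) = c *\<^sub>C F x"
    and "\<And>x. norm (F x) \<le> K * norm x"
  shows "bounded_clinear F"
  unfolding bounded_clinear_def
proof
  show "bounded_linear F"
    using assms by (intro bounded_linear_intro[of F K]) (simp_all add: scaleR_scaleC mult.commute)
qed (use assms in blast)

lemma bounded_clinear_add: "bounded_clinear F \<Longrightarrow> F (x + y) = F x + F y"
  and bounded_clinear_diff: "bounded_clinear F \<Longrightarrow> F (x - y) = F x - F y"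
  and bounded_clinear_scaleC: "bounded_clinear F \<Longrightarrow> F (c *\<^sub>C x) = c *\<^sub>C F x"
  unfolding bounded_clinear_def
  by (simp_all add: linear_simps)

lemma bounded_clinear_bound:
  assumes "bounded_clinear F"
  obtains K where "0 \<le> K" "\<And>x. norm (F x) \<le> K * norm x"
  using assms bounded_linear.nonneg_bounded unfolding bounded_clinear_def
  by (metis mult.commute)

lemma bounded_clinear_compose:
  assumes "bounded_clinear F" "bounded_clinear G"
  shows "bounded_clinear (\<lambda>x. F (G x))"
  using assms bounded_linear_compose unfolding bounded_clinear_def by auto

lemma bounded_clinear_plus:
  assumes "bounded_clinear F" "bounded_clinear G"
  shows "bounded_clinear (\<lambda>x. F x + G x)"
  using assms by (auto simp: bounded_clinear_def scaleC_add_right intro: bounded_linear_add)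

lemma bounded_clinear_scaleC_fun:
  assumes "bounded_clinear F"
  shows "bounded_clinear (\<lambda>x. c *\<^sub>C F x)"
proof -
  obtain K where "\<And>x. norm (F x) \<le> K * norm x"
    using assms bounded_clinear_bound by blast
  then have "norm (c *\<^sub>C F x) \<le> (cmod c * K) * norm x" for x
    by (simp add: norm_scaleC mult.assoc mult_left_mono)
  then show ?thesis
    using assms
    by (intro bounded_clinearI[where K = "cmod c * K"])
      (simp_all add: bounded_clinear_add bounded_clinear_scaleC scaleC_add_right scaleC_scaleC
        mult.commute)
qed

lemma bounded_clinear_scaleR_fun:
  "bounded_clinear F \<Longrightarrow> bounded_clinear (\<lambda>x. r *\<^sub>R F x)"
  by (simp add: scaleR_scaleC bounded_clinear_scaleC_fun)

lemma bounded_clinear_minus: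
  assumes "bounded_clinear F" "bounded_clinear G"
  shows "bounded_clinear (\<lambda>x. F x - G x)"
  using bounded_clinear_plus[OF assms(1) bounded_clinear_scaleR_fun[OF assms(2), of "-1"]] by simp

lemma bounded_clinear_ident: "bounded_clinear (\<lambda>x. x)"
  by (simp add: bounded_clinear_def bounded_linear_ident)

lemma cinner_ext:
  fixes a b :: "'a::complex_inner"
  assumes "\<And>x. cinner x a = cinner x b"
  shows "a = b"
proof -
  have "cinner (a - b) (a - b) = 0"
    using assms by (simp add: cinner_diff_right[of _ a b])
  then show ?thesis
    by (simp add: cinner_self)
qed

lemma hilbert_adjoint_eqI:
  fixes F :: "'a::complex_inner \<Rightarrow> 'b::complex_inner"
  assumes "\<And>x y. cinner (F x) y = cinner x (G y)"
  shows "hilbert_adjoint F = G"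
  unfolding hilbert_adjoint_def
proof (rule the_equality)
  fix G' assume G': "\<forall>x y. cinner (F x) y = cinner x (G' y)"
  show "G' = G"
  proof (rule ext, rule cinner_ext)
    show "cinner x (G' y) = cinner x (G y)" for x y
      by (simp add: assms[symmetric] G'[rule_format, symmetric])
  qed
qed (use assms in blast)

lemma
  fixes F :: "'a::complex_hilbert \<Rightarrow> 'b::complex_inner"
  assumes F: "bounded_clinear F"
  shows cinner_hilbert_adjoint: "\<And>x y. cinner (F x) y = cinner x (hilbert_adjoint F y)"
    and bounded_clinear_hilbert_adjoint: "bounded_clinear (hilbert_adjoint F)"
proof -
  obtain K where K: "0 \<le> K" "\<And>x. norm (F x) \<le> K * norm x"
    using F bounded_clinear_bound by blast
  have "\<exists>z. \<forall>x. cinner (F x) y = cinner x z" for y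
  proof -
    have "bounded_linear (\<lambda>x. inner (F x) y)"
      using F bounded_linear_compose[OF bounded_linear_inner_left, of F y]
      unfolding bounded_clinear_def by blast
    then obtain z where z: "\<And>x. inner (F x) y = inner x z"
      using Riesz_on_closed_subspace[of "\<lambda>x. inner (F x) y" UNIV] by auto
    \<comment> \<open>The imaginary parts agree as well, since up to sign they are real parts at \<open>\<i> *\<^sub>C x\<close>.\<close>
    have "cinner (F x) y = cinner x z" for x
    proof (rule complex_eqI)
      show "Re (cinner (F x) y) = Re (cinner x z)"
        using z by (simp add: inner_eq_Re_cinner)
      show "Im (cinner (F x) y) = Im (cinner x z)"
        using z[of "\<i> *\<^sub>C x"] F
        by (simp add: inner_eq_Re_cinner bounded_clinear_scaleC cinner_scaleC_left)
    qed
    then show ?thesis by blast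
  qed
  then obtain G where G: "\<And>x y. cinner (F x) y = cinner x (G y)"
    by metis
  have eq: "hilbert_adjoint F = G"
    using G by (rule hilbert_adjoint_eqI)
  show "cinner (F x) y = cinner x (hilbert_adjoint F y)" for x y
    by (simp add: eq G)
  show "bounded_clinear (hilbert_adjoint F)"
    unfolding eq
  proof (rule bounded_clinearI)
    show "G (x + y) = G x + G y" for x y
      by (rule cinner_ext) (simp add: cinner_add_right flip: G)
    show "G (c *\<^sub>C x) = c *\<^sub>C G x" for c x
      by (rule cinner_ext) (simp add: cinner_scaleC_right flip: G)
    show "norm (G y) \<le> K * norm y" for y
    proof (rule norm_le_if_cinner_le)
      fix g
      have "cmod (cinner (G y) g) = cmod (cinner (F g) y)"
        by (metis G cinner_commute complex_mod_cnj)
      also have "\<dots> \<le> norm (F g) * norm y"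
        by (rule cinner_Cauchy_Schwarz)
      also have "\<dots> \<le> K * norm g * norm y"
        by (simp add: K mult_right_mono)
      finally show "cmod (cinner (G y) g) \<le> K * norm y * norm g"
        by (simp add: mult_ac)
    qed (simp add: K)
  qed
qed

lemma cinner_hilbert_adjoint_left:
  fixes F :: "'a::complex_hilbert \<Rightarrow> 'b::complex_inner"
  assumes "bounded_clinear F"
  shows "cinner (hilbert_adjoint F y) x = cinner y (F x)"
  by (metis assms cinner_commute cinner_hilbert_adjoint)

lemma norm_sympl_J [simp]: "norm (sympl_J f) = norm f" for f :: "'k \<times> 'k::complex_inner"
  by (simp add: sympl_J_def norm_prod_def add.commute)

lemma bounded_clinear_sympl_J: "bounded_clinear (sympl_J :: 'k \<times> 'k \<Rightarrow> 'k \<times> 'k::complex_inner)"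
proof -
  have "- (c *\<^sub>C x) = c *\<^sub>C - x" for c and x :: 'k
    using complex_vector.scale_minus_right[of c x] by simp
  then show ?thesis
    by (intro bounded_clinearI[where K = 1]) (simp_all, simp_all add: sympl_J_def scaleC_prod_def)
qed

section \<open>Resolvents of self-adjoint operators\<close>

text \<open>For \<open>\<zeta>\<close> in the resolvent set this says that the resolvent has norm at most \<open>M\<close>; unlike that,
  it makes sense before \<open>S - \<zeta>\<close> is known to be surjective.\<close>

definition bounded_below_at :: "('a::complex_inner \<times> 'a) set \<Rightarrow> complex \<Rightarrow> real \<Rightarrow> bool" where
  "bounded_below_at S \<zeta> M \<longleftrightarrow> (\<forall>(u, v)\<in>S. norm u \<le> M * norm (v - \<zeta> *\<^sub>C u))"

lemma self_adjoint_op_symmetric: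
  "self_adjoint_op S \<Longrightarrow> (u, u') \<in> S \<Longrightarrow> (v, v') \<in> S \<Longrightarrow> cinner u' v = cinner u v'"
  unfolding self_adjoint_op_def op_adjoint_def by blast

lemma self_adjoint_opI:
  "self_adjoint_op S \<Longrightarrow> (\<And>u u'. (u, u') \<in> S \<Longrightarrow> cinner u' v = cinner u w) \<Longrightarrow> (v, w) \<in> S"
  by (auto simp: self_adjoint_op_def op_adjoint_def)

lemma self_adjoint_op_add: "self_adjoint_op S \<Longrightarrow> (u, u') \<in> S \<Longrightarrow> (v, v') \<in> S \<Longrightarrow> (u + v, u' + v') \<in> S"
  using complex_vector.subspace_add[of S "(u, u')" "(v, v')"]
  by (auto simp: self_adjoint_op_def linear_op_def)

lemma self_adjoint_op_scaleC: "self_adjoint_op S \<Longrightarrow> (u, u') \<in> S \<Longrightarrow> (c *\<^sub>C u, c *\<^sub>C u') \<in> S"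
  using complex_vector.subspace_scale[of S "(u, u')" c]
  by (auto simp: self_adjoint_op_def linear_op_def scaleC_prod_def)

lemma self_adjoint_op_diff: "self_adjoint_op S \<Longrightarrow> (u, u') \<in> S \<Longrightarrow> (v, v') \<in> S \<Longrightarrow> (u - v, u' - v') \<in> S"
  using complex_vector.subspace_diff[of S "(u, u')" "(v, v')"]
  by (auto simp: self_adjoint_op_def linear_op_def)

text \<open>A self-adjoint operator is normal: \<open>norm (S u - \<zeta> *\<^sub>C u)\<close> is invariant under conjugation of
  \<open>\<zeta>\<close>, because \<open>cinner (S u) u\<close> is real.\<close>

lemma norm_shift_cnj:
  assumes "self_adjoint_op S" "(u, v) \<in> S"
  shows "norm (v - cnj \<zeta> *\<^sub>C u) = norm (v - \<zeta> *\<^sub>C u)"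
proof -
  have sym: "cinner u v = cinner v u"
    using self_adjoint_op_symmetric[OF assms(1,2,2)] by simp
  have "complex_of_real ((norm (v - cnj \<zeta> *\<^sub>C u))\<^sup>2) = complex_of_real ((norm (v - \<zeta> *\<^sub>C u))\<^sup>2)"
    unfolding cinner_self[symmetric] by (simp add: cinner_simps sym algebra_simps)
  then have "(norm (v - cnj \<zeta> *\<^sub>C u))\<^sup>2 = (norm (v - \<zeta> *\<^sub>C u))\<^sup>2"
    using of_real_eq_iff by blast
  then show ?thesis
    by (simp add: power2_eq_iff_nonneg)
qed

lemma bounded_below_at_cnj:
  "self_adjoint_op S \<Longrightarrow> bounded_below_at S (cnj \<zeta>) M \<longleftrightarrow> bounded_below_at S \<zeta> M"
  unfolding bounded_below_at_def by (auto simp: norm_shift_cnj)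

lemma tendsto_cinner_right:
  fixes x :: "'a::complex_inner"
  assumes "f \<longlonglongrightarrow> l"
  shows "(\<lambda>n. cinner x (f n)) \<longlonglongrightarrow> cinner x l"
proof -
  have "bounded_linear (cinner x)"
    by (intro bounded_linear_intro[where K = "norm x"])
      (auto simp: cinner_simps scaleR_conv_of_real mult.commute intro: order_trans[OF cinner_Cauchy_Schwarz])
  then show ?thesis
    using assms by (rule bounded_linear.tendsto)
qed

lemma self_adjoint_op_closed:
  assumes "self_adjoint_op S" and "\<And>n. (u n, v n) \<in> S" and "u \<longlonglongrightarrow> x" "v \<longlonglongrightarrow> y"
  shows "(x, y) \<in> S"
proof (rule self_adjoint_opI[OF assms(1)])
  fix a b assume ab: "(a, b) \<in> S"
  have "(\<lambda>n. cinner b (u n)) \<longlonglongrightarrow> cinner b x" "(\<lambda>n. cinner a (v n)) \<longlonglongrightarrow> cinner a y"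
    by (simp_all add: assms tendsto_cinner_right)
  moreover have "cinner b (u n) = cinner a (v n)" for n
    using self_adjoint_op_symmetric[OF assms(1) ab assms(2)] .
  ultimately show "cinner b x = cinner a y"
    using LIMSEQ_unique by auto
qed

text \<open>The range of \<open>S - \<zeta>\<close> is closed by the lower bound and the closedness of \<open>S\<close>, and its
  orthogonal complement is the kernel of \<open>S - cnj \<zeta>\<close>, which the lower bound at \<open>cnj \<zeta>\<close>
  trivialises.\<close>

lemma bounded_below_surjective:
  fixes S :: "('h::complex_hilbert \<times> 'h) set"
  assumes S: "self_adjoint_op S" and M: "bounded_below_at S \<zeta> M"
  shows "\<exists>u. (u, f + \<zeta> *\<^sub>C u) \<in> S"
proof -
  define V where "V = {g. \<exists>u. (u, g + \<zeta> *\<^sub>C u) \<in> S}"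
  have VI: "v - \<zeta> *\<^sub>C u \<in> V" if "(u, v) \<in> S" for u v
    using that unfolding V_def by (auto intro!: exI[of _ u])
  have M': "norm u \<le> M * norm g" if "(u, g + \<zeta> *\<^sub>C u) \<in> S" for u g
    using M that unfolding bounded_below_at_def by fastforce
  have scaleC: "c *\<^sub>C g \<in> V" if "g \<in> V" for c g
  proof -
    obtain u where "(u, g + \<zeta> *\<^sub>C u) \<in> S"
      using \<open>g \<in> V\<close> V_def by blast
    from self_adjoint_op_scaleC[OF S this, of c] have "(c *\<^sub>C u, c *\<^sub>C g + \<zeta> *\<^sub>C (c *\<^sub>C u)) \<in> S"
      by (simp add: scaleC_add_right scaleC_scaleC mult.commute)
    then show ?thesis
      unfolding V_def by blast
  qed
  have subspace: "subspace V"
  proof (rule subspaceI)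
    have "(0, 0) \<in> S"
      using S complex_vector.subspace_0[of S] by (auto simp: self_adjoint_op_def linear_op_def zero_prod_def)
    then show "0 \<in> V"
      unfolding V_def by (auto intro!: exI[of _ 0])
    show "r *\<^sub>R x \<in> V" if "x \<in> V" for x r
      using scaleC[OF that] by (simp add: scaleR_scaleC)
    show "x + y \<in> V" if xy: "x \<in> V" "y \<in> V" for x y
    proof -
      obtain a b where "(a, x + \<zeta> *\<^sub>C a) \<in> S" "(b, y + \<zeta> *\<^sub>C b) \<in> S"
        using xy unfolding V_def by blast
      from self_adjoint_op_add[OF S this] have "(a + b, (x + y) + \<zeta> *\<^sub>C (a + b)) \<in> S"
        by (simp add: scaleC_add_right add_ac)
      then show ?thesis
        unfolding V_def by blast
    qed
  qed
  have "closed V"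
    unfolding closed_sequential_limits
  proof (intro allI impI, elim conjE)
    fix g l assume "\<forall>n. g n \<in> V" and g: "g \<longlonglongrightarrow> l"
    then obtain u where u: "\<And>n. (u n, g n + \<zeta> *\<^sub>C u n) \<in> S"
      unfolding V_def by (simp, metis)
    have bound: "norm (u m - u n) \<le> M * norm (g m - g n)" for m n
    proof (rule M')
      have "(u m - u n, (g m + \<zeta> *\<^sub>C u m) - (g n + \<zeta> *\<^sub>C u n)) \<in> S"
        by (rule self_adjoint_op_diff[OF S u u])
      moreover have "(g m + \<zeta> *\<^sub>C u m) - (g n + \<zeta> *\<^sub>C u n) = g m - g n + \<zeta> *\<^sub>C (u m - u n)"
        by (simp add: complex_vector.scale_right_diff_distrib)
      ultimately show "(u m - u n, g m - g n + \<zeta> *\<^sub>C (u m - u n)) \<in> S"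
        by simp
    qed
    have "Cauchy u"
    proof (rule metric_CauchyI)
      fix e :: real assume "0 < e"
      have "Cauchy g"
        using g LIMSEQ_imp_Cauchy by blast
      then obtain N where N: "\<And>m n. m \<ge> N \<Longrightarrow> n \<ge> N \<Longrightarrow> dist (g m) (g n) < e / (\<bar>M\<bar> + 1)"
        using \<open>0 < e\<close> unfolding Cauchy_def by (metis abs_ge_zero add_nonneg_pos divide_pos_pos zero_less_one)
      show "\<exists>N. \<forall>m\<ge>N. \<forall>n\<ge>N. dist (u m) (u n) < e"
      proof (intro exI allI impI)
        fix m n assume "m \<ge> N" "n \<ge> N"
        then have "norm (g m - g n) < e / (\<bar>M\<bar> + 1)"
          using N by (simp add: dist_norm)
        have "norm (u m - u n) \<le> M * norm (g m - g n)"
          by (rule bound)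
        also have "\<dots> \<le> (\<bar>M\<bar> + 1) * norm (g m - g n)"
          by (rule mult_right_mono) auto
        also have "\<dots> < e"
          using \<open>norm (g m - g n) < e / (\<bar>M\<bar> + 1)\<close> by (simp add: pos_less_divide_eq mult.commute add_nonneg_pos)
        finally show "dist (u m) (u n) < e"
          by (simp add: dist_norm)
      qed
    qed
    then obtain x where x: "u \<longlonglongrightarrow> x"
      using Cauchy_convergent convergent_def by blast
    have "bounded_linear (\<lambda>x::'h. \<zeta> *\<^sub>C x)"
      using bounded_clinear_scaleC_fun[OF bounded_clinear_ident] by (auto simp: bounded_clinear_def)
    then have "(\<lambda>n. \<zeta> *\<^sub>C u n) \<longlonglongrightarrow> \<zeta> *\<^sub>C x"
      using x by (rule bounded_linear.tendsto)
    then have "(x, l + \<zeta> *\<^sub>C x) \<in> S"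
      using self_adjoint_op_closed[OF S u x] g tendsto_add by blast
    then show "l \<in> V"
      unfolding V_def by blast
  qed
  have "bounded_linear (\<lambda>x. inner x f)"
    by (rule bounded_linear_inner_left)
  from Riesz_on_closed_subspace[OF this \<open>closed V\<close> subspace]
  obtain y where "y \<in> V" and y: "\<And>x. x \<in> V \<Longrightarrow> inner x f = inner x y"
    by blast
  have orth: "cinner x (f - y) = 0" if "x \<in> V" for x
  proof (rule complex_eqI)
    show "Re (cinner x (f - y)) = Re 0"
      using y[OF that] by (simp add: inner_eq_Re_cinner cinner_diff_right)
    show "Im (cinner x (f - y)) = Im 0"
      using y[OF scaleC[OF that, of \<i>]] by (simp add: inner_eq_Re_cinner cinner_simps)
  qed
  have "(f - y, cnj \<zeta> *\<^sub>C (f - y)) \<in> S"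
  proof (rule self_adjoint_opI[OF S])
    fix u v assume "(u, v) \<in> S"
    then have "cinner (v - \<zeta> *\<^sub>C u) (f - y) = 0"
      using VI orth by blast
    then show "cinner v (f - y) = cinner u (cnj \<zeta> *\<^sub>C (f - y))"
      by (simp add: cinner_diff_left[of v] cinner_scaleC_left cinner_scaleC_right)
  qed
  then have "norm (f - y) \<le> M * norm (cnj \<zeta> *\<^sub>C (f - y) - cnj \<zeta> *\<^sub>C (f - y))"
    using M bounded_below_at_cnj[OF S, of \<zeta> M] unfolding bounded_below_at_def by blast
  then have "f = y"
    by simp
  with \<open>y \<in> V\<close> show ?thesis
    unfolding V_def by blast
qed

lemma op_shift_iff: "(u, f) \<in> op_shift S \<zeta> \<longleftrightarrow> (u, f + \<zeta> *\<^sub>C u) \<in> S"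
proof -
  have "(u, f) \<in> op_shift S \<zeta> \<longleftrightarrow> (\<exists>v. f = v - \<zeta> *\<^sub>C u \<and> (u, v) \<in> S)"
    by (auto simp: op_shift_def)
  also have "\<dots> \<longleftrightarrow> (u, f + \<zeta> *\<^sub>C u) \<in> S"
    by (metis add_diff_cancel diff_add_cancel)
  finally show ?thesis .
qed

lemma
  assumes "\<zeta> \<notin> Spec S"
  shows resolvent_in: "(resolvent S \<zeta> f, f + \<zeta> *\<^sub>C resolvent S \<zeta> f) \<in> S"
    and resolvent_unique: "(u, f + \<zeta> *\<^sub>C u) \<in> S \<Longrightarrow> resolvent S \<zeta> f = u"
    and bounded_clinear_resolvent: "bounded_clinear (resolvent S \<zeta>)"
proof -
  have ex1: "\<exists>!u. (u, f) \<in> op_shift S \<zeta>"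
    using assms by (auto simp: Spec_def)
  from theI'[OF ex1] show "(resolvent S \<zeta> f, f + \<zeta> *\<^sub>C resolvent S \<zeta> f) \<in> S"
    by (simp add: resolvent_def op_shift_iff)
  show "resolvent S \<zeta> f = u" if "(u, f + \<zeta> *\<^sub>C u) \<in> S"
    unfolding resolvent_def using ex1 that by (intro the1_equality) (simp_all add: op_shift_iff)
  show "bounded_clinear (resolvent S \<zeta>)"
    using assms by (auto simp: Spec_def)
qed

text \<open>By surjectivity above, the lower bound is all that has to be checked.\<close>

lemma not_Spec_iff_bounded_below:
  fixes S :: "('h::complex_hilbert \<times> 'h) set"
  assumes S: "self_adjoint_op S"
  shows "\<zeta> \<notin> Spec S \<longleftrightarrow> (\<exists>M\<ge>0. bounded_below_at S \<zeta> M)"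
proof
  assume \<zeta>: "\<zeta> \<notin> Spec S"
  obtain M where M: "M \<ge> 0" "\<And>f. norm (resolvent S \<zeta> f) \<le> M * norm f"
    using bounded_clinear_bound[OF bounded_clinear_resolvent[OF \<zeta>]] by blast
  have "norm u \<le> M * norm (v - \<zeta> *\<^sub>C u)" if "(u, v) \<in> S" for u v
    using M(2)[of "v - \<zeta> *\<^sub>C u"] resolvent_unique[OF \<zeta>, of u "v - \<zeta> *\<^sub>C u"] that by simp
  then show "\<exists>M\<ge>0. bounded_below_at S \<zeta> M"
    using M(1) unfolding bounded_below_at_def by blast
next
  assume "\<exists>M\<ge>0. bounded_below_at S \<zeta> M"
  then obtain M where M: "M \<ge> 0" "bounded_below_at S \<zeta> M"
    by blast
  have unique: "u = v" if "(u, f + \<zeta> *\<^sub>C u) \<in> S" "(v, f + \<zeta> *\<^sub>C v) \<in> S" for f u v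
  proof -
    have "(u - v, (f + \<zeta> *\<^sub>C u) - (f + \<zeta> *\<^sub>C v)) \<in> S"
      by (rule self_adjoint_op_diff[OF S that])
    then have "norm (u - v) \<le> M * norm ((f + \<zeta> *\<^sub>C u) - (f + \<zeta> *\<^sub>C v) - \<zeta> *\<^sub>C (u - v))"
      using M unfolding bounded_below_at_def by blast
    then show ?thesis
      by (simp add: complex_vector.scale_right_diff_distrib)
  qed
  have ex1: "\<exists>!u. (u, f) \<in> op_shift S \<zeta>" for f
    using bounded_below_surjective[OF S M(2), of f] unique unfolding op_shift_iff by blast
  have in_S: "(resolvent S \<zeta> f, f + \<zeta> *\<^sub>C resolvent S \<zeta> f) \<in> S" for f
    using theI'[OF ex1[of f]] by (simp add: resolvent_def op_shift_iff)
  have eq: "resolvent S \<zeta> f = u" if "(u, f + \<zeta> *\<^sub>C u) \<in> S" for f u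
    using unique in_S that by blast
  have "bounded_clinear (resolvent S \<zeta>)"
  proof (rule bounded_clinearI)
    show "resolvent S \<zeta> (f + g) = resolvent S \<zeta> f + resolvent S \<zeta> g" for f g
      using self_adjoint_op_add[OF S in_S[of f] in_S[of g]]
      by (intro eq) (simp add: scaleC_add_right add_ac)
    show "resolvent S \<zeta> (c *\<^sub>C f) = c *\<^sub>C resolvent S \<zeta> f" for c f
      using self_adjoint_op_scaleC[OF S in_S[of f], of c]
      by (intro eq) (simp add: scaleC_add_right scaleC_scaleC mult.commute)
    show "norm (resolvent S \<zeta> f) \<le> M * norm f" for f
      using M(2) in_S[of f] unfolding bounded_below_at_def by fastforce
  qed
  with ex1 show "\<zeta> \<notin> Spec S"
    by (simp add: Spec_def)
qed

lemma cnj_not_Spec: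
  fixes S :: "('h::complex_hilbert \<times> 'h) set"
  assumes "self_adjoint_op S" "\<zeta> \<notin> Spec S"
  shows "cnj \<zeta> \<notin> Spec S"
  using assms by (simp add: not_Spec_iff_bounded_below bounded_below_at_cnj)

lemma norm_resolvent_le:
  assumes "\<zeta> \<notin> Spec S" "bounded_below_at S \<zeta> M"
  shows "norm (resolvent S \<zeta> f) \<le> M * norm f"
  using resolvent_in[OF assms(1), of f] assms(2) unfolding bounded_below_at_def by fastforce

lemma cinner_resolvent:
  fixes S :: "('h::complex_hilbert \<times> 'h) set"
  assumes S: "self_adjoint_op S" and \<zeta>: "\<zeta> \<notin> Spec S"
  shows "cinner (resolvent S \<zeta> f) g = cinner f (resolvent S (cnj \<zeta>) g)"
  using self_adjoint_op_symmetric[OF S resolvent_in[OF \<zeta>, of f]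
      resolvent_in[OF cnj_not_Spec[OF S \<zeta>], of g]]
  by (simp add: cinner_simps)

text \<open>Lower bounds survive small changes of the spectral parameter, so they can be chosen uniformly
  on compact subsets of the resolvent set.\<close>

lemma bounded_below_at_perturb:
  assumes M: "bounded_below_at S \<zeta> M" "M \<ge> 0" and near: "M * cmod (\<eta> - \<zeta>) \<le> 1 / 2"
  shows "bounded_below_at S \<eta> (2 * M)"
  unfolding bounded_below_at_def
proof safe
  fix u v assume "(u, v) \<in> S"
  then have "norm u \<le> M * norm (v - \<zeta> *\<^sub>C u)"
    using M unfolding bounded_below_at_def by blast
  also have "v - \<zeta> *\<^sub>C u = (v - \<eta> *\<^sub>C u) + (\<eta> - \<zeta>) *\<^sub>C u"
    by (simp add: complex_vector.scale_left_diff_distrib)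
  also have "norm \<dots> \<le> norm (v - \<eta> *\<^sub>C u) + cmod (\<eta> - \<zeta>) * norm u"
    using norm_triangle_ineq by (metis norm_scaleC)
  finally have "norm u \<le> M * norm (v - \<eta> *\<^sub>C u) + M * cmod (\<eta> - \<zeta>) * norm u"
    using M(2) by (simp add: distrib_left mult.assoc mult_left_mono)
  also have "\<dots> \<le> M * norm (v - \<eta> *\<^sub>C u) + 1 / 2 * norm u"
    using near by (intro add_left_mono mult_right_mono) auto
  finally show "norm u \<le> 2 * M * norm (v - \<eta> *\<^sub>C u)"
    by simp
qed

lemma bounded_below_at_mono: "bounded_below_at S \<zeta> M \<Longrightarrow> M \<le> N \<Longrightarrow> bounded_below_at S \<zeta> N"
  unfolding bounded_below_at_def by (fastforce intro: order_trans mult_right_mono)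

lemma bounded_below_on_compact:
  fixes S :: "('h::complex_hilbert \<times> 'h) set"
  assumes S: "self_adjoint_op S" and Z: "compact Z" "\<And>\<zeta>. \<zeta> \<in> Z \<Longrightarrow> \<zeta> \<notin> Spec S"
  obtains M where "M \<ge> 0" "\<And>\<zeta>. \<zeta> \<in> Z \<Longrightarrow> bounded_below_at S \<zeta> M"
proof -
  have "\<forall>\<zeta>\<in>Z. \<exists>M>0. bounded_below_at S \<zeta> M"
    using not_Spec_iff_bounded_below[OF S] Z(2)
    by (metis bounded_below_at_mono add_nonneg_pos zero_less_one less_add_one less_imp_le)
  then obtain m where m: "\<And>\<zeta>. \<zeta> \<in> Z \<Longrightarrow> m \<zeta> > 0 \<and> bounded_below_at S \<zeta> (m \<zeta>)"
    by metis
  have "Z \<subseteq> (\<Union>\<zeta>\<in>Z. ball \<zeta> (1 / (2 * m \<zeta>)))"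
    using m by force
  then obtain F where F: "F \<subseteq> Z" "finite F" "Z \<subseteq> (\<Union>\<zeta>\<in>F. ball \<zeta> (1 / (2 * m \<zeta>)))"
    using compactE_image[OF Z(1), of Z "\<lambda>\<zeta>. ball \<zeta> (1 / (2 * m \<zeta>))"] by auto
  define M where "M = (\<Sum>\<zeta>\<in>F. 2 * m \<zeta>)"
  have "M \<ge> 0"
    unfolding M_def using F(1) m by (intro sum_nonneg) (force intro: less_imp_le)
  moreover have "bounded_below_at S \<eta> M" if \<eta>: "\<eta> \<in> Z" for \<eta>
  proof -
    obtain \<zeta> where \<zeta>: "\<zeta> \<in> F" "dist \<zeta> \<eta> < 1 / (2 * m \<zeta>)"
      using F(3) \<eta> by auto
    have mp: "m \<zeta> > 0" "bounded_below_at S \<zeta> (m \<zeta>)"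
      using m F(1) \<zeta>(1) by auto
    have "m \<zeta> * cmod (\<eta> - \<zeta>) \<le> 1 / 2"
      using \<zeta>(2) mp(1) by (simp add: dist_norm norm_minus_commute field_simps)
    then have "bounded_below_at S \<eta> (2 * m \<zeta>)"
      using bounded_below_at_perturb mp by (metis less_imp_le)
    moreover have "2 * m \<zeta> \<le> M"
      unfolding M_def using \<zeta>(1) F m by (intro member_le_sum) (force intro: less_imp_le)+
    ultimately show ?thesis
      by (rule bounded_below_at_mono)
  qed
  ultimately show ?thesis
    by (rule that)
qed

section \<open>Traces and resolvents of self-adjoint extensions\<close>

definition lagrangian_extension ::
  "('h \<Rightarrow> 'k::complex_inner \<times> 'k) \<Rightarrow> ('h::complex_inner \<times> 'h) set \<Rightarrow> ('k \<times> 'k \<Rightarrow> 'k \<times> 'k) \<Rightarrow> ('h \<times> 'h) set \<Rightarrow> bool"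
where
  "lagrangian_extension T A P S \<longleftrightarrow>
     orthogonal_projection P \<and> lagrangian (range P) \<and>
     self_adjoint_op S \<and> A \<subseteq> S \<and> T ` Domain S = range P"

text \<open>The bound \<open>K\<close> of the trace is a parameter, since all later estimates are explicit in it.\<close>

locale boundary_trace =
  fixes A :: "('h::complex_hilbert \<times> 'h) set"
    and \<Gamma>0 \<Gamma>1 :: "'h \<Rightarrow> 'k::complex_hilbert"
    and K :: real
  assumes dense: "densely_defined A"
    and triplet: "boundary_triplet A \<Gamma>0 \<Gamma>1"
    and K_nonneg: "0 \<le> K"
    and trace_bound: "u \<in> hplus A \<Longrightarrow> norm (trace_map \<Gamma>0 \<Gamma>1 u) \<le> K * hplus_norm A u"
begin

abbreviation "T \<equiv> trace_map \<Gamma>0 \<Gamma>1"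
abbreviation "extension \<equiv> lagrangian_extension T A"

lemma adjoint_add: "(u, u') \<in> op_adjoint A \<Longrightarrow> (v, v') \<in> op_adjoint A \<Longrightarrow> (u + v, u' + v') \<in> op_adjoint A"
  and adjoint_diff: "(u, u') \<in> op_adjoint A \<Longrightarrow> (v, v') \<in> op_adjoint A \<Longrightarrow> (u - v, u' - v') \<in> op_adjoint A"
  and adjoint_scaleC: "(u, u') \<in> op_adjoint A \<Longrightarrow> (c *\<^sub>C u, c *\<^sub>C u') \<in> op_adjoint A"
  by (fastforce simp: op_adjoint_def cinner_simps)+

text \<open>Density of the domain of \<open>A\<close> makes the adjoint single-valued.\<close>

lemma op_apply_adjoint:
  assumes "(u, v) \<in> op_adjoint A"
  shows "op_apply (op_adjoint A) u = v"
  unfolding op_apply_def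
proof (rule the_equality)
  fix w assume w: "(u, w) \<in> op_adjoint A"
  have "Domain A \<subseteq> {x. inner x (w - v) = 0}"
  proof clarify
    fix x y assume "(x, y) \<in> A"
    then have "cinner x w = cinner x v"
      using assms w unfolding op_adjoint_def by fastforce
    then show "inner x (w - v) = 0"
      by (simp add: inner_eq_Re_cinner cinner_diff_right)
  qed
  moreover have "closed {x. inner x (w - v) = 0}"
    by (intro closed_Collect_eq continuous_intros)
  ultimately have "closure (Domain A) \<subseteq> {x. inner x (w - v) = 0}"
    by (rule closure_minimal)
  then have "inner (w - v) (w - v) = 0"
    using dense unfolding densely_defined_def by blast
  then show "w = v"
    by simp
qed (fact assms)

lemma hplus_norm_le:
  assumes "(u, v) \<in> op_adjoint A"
  shows "hplus_norm A u \<le> norm u + norm v"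
proof -
  have "hplus_norm A u = sqrt ((norm u)\<^sup>2 + (norm v)\<^sup>2)"
    by (simp add: hplus_norm_def hplus_cinner_def op_apply_adjoint[OF assms] cinner_self)
  also have "\<dots> \<le> norm u + norm v"
    by (rule sqrt_sum_squares_le_sum) simp_all
  finally show ?thesis .
qed

lemma norm_trace_le:
  assumes "(u, v) \<in> op_adjoint A"
  shows "norm (T u) \<le> K * (norm u + norm v)"
proof -
  have "u \<in> hplus A"
    using assms by (auto simp: hplus_def)
  then have "norm (T u) \<le> K * hplus_norm A u"
    by (rule trace_bound)
  also have "\<dots> \<le> K * (norm u + norm v)"
    using hplus_norm_le[OF assms] K_nonneg by (rule mult_left_mono)
  finally show ?thesis .
qed

lemma trace_add: "(u, u') \<in> op_adjoint A \<Longrightarrow> (v, v') \<in> op_adjoint A \<Longrightarrow> T (u + v) = T u + T v"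
  and trace_scaleC: "(u, u') \<in> op_adjoint A \<Longrightarrow> T (c *\<^sub>C u) = c *\<^sub>C T u"
  using triplet unfolding boundary_triplet_def hplus_def by blast+

lemma trace_diff:
  assumes "(u, u') \<in> op_adjoint A" "(v, v') \<in> op_adjoint A"
  shows "T (u - v) = T u - T v"
  using trace_add[OF adjoint_diff[OF assms] assms(2)] by (simp add: algebra_simps)

lemma Green:
  assumes "(u, u') \<in> op_adjoint A" "(v, v') \<in> op_adjoint A"
  shows "cinner u' v - cinner u v' = cinner (sympl_J (T u)) (T v)"
proof -
  have "u \<in> hplus A" "v \<in> hplus A"
    using assms by (auto simp: hplus_def)
  then have "cinner (op_apply (op_adjoint A) u) v - cinner u (op_apply (op_adjoint A) v) =
      cinner (\<Gamma>1 u) (\<Gamma>0 v) - cinner (\<Gamma>0 u) (\<Gamma>1 v)"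
    using triplet unfolding boundary_triplet_def by blast
  then show ?thesis
    by (simp add: op_apply_adjoint[OF assms(1)] op_apply_adjoint[OF assms(2)] trace_map_def
        flip: sympl_form_eq_cinner_J) (simp add: sympl_form_def)
qed

text \<open>A bounded operator into the graph of the adjoint is bounded for the graph norm, for which the
  trace is bounded.\<close>

lemma graph_bounded:
  assumes F: "bounded_clinear F" "bounded_clinear F'" "\<And>f. (F f, F' f) \<in> op_adjoint A"
  shows trace_bounded_clinear: "bounded_clinear (\<lambda>f. T (F f))"
    and bounded_into_hplusI: "bounded_into_hplus A F"
proof -
  obtain C C' where C: "\<And>f. norm (F f) \<le> C * norm f" "\<And>f. norm (F' f) \<le> C' * norm f"
    using F bounded_clinear_bound by metis
  then have sum: "norm (F f) + norm (F' f) \<le> (C + C') * norm f" for f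
    by (metis add_mono distrib_right)
  show "bounded_clinear (\<lambda>f. T (F f))"
  proof (rule bounded_clinearI)
    show "norm (T (F f)) \<le> K * (C + C') * norm f" for f
      using norm_trace_le[OF F(3)[of f]] mult_left_mono[OF sum[of f] K_nonneg] by (simp add: mult.assoc)
  qed (simp_all add: F bounded_clinear_add bounded_clinear_scaleC trace_add[OF F(3) F(3)] trace_scaleC[OF F(3)])
  have "F f \<in> hplus A" for f
    using F(3) by (auto simp: hplus_def)
  moreover have "hplus_norm A (F f) \<le> (C + C') * norm f" for f
    using hplus_norm_le[OF F(3)[of f]] sum[of f] by simp
  ultimately show "bounded_into_hplus A F"
    using F bounded_clinear_add bounded_clinear_scaleC unfolding bounded_into_hplus_def by blast
qed

lemma extension_subset_adjoint:
  assumes "extension P S"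
  shows "S \<subseteq> op_adjoint A"
proof clarify
  fix u v assume uv: "(u, v) \<in> S"
  have sa: "self_adjoint_op S" and AS: "A \<subseteq> S"
    using assms by (auto simp: lagrangian_extension_def)
  show "(u, v) \<in> op_adjoint A"
    unfolding op_adjoint_def using self_adjoint_op_symmetric[OF sa subsetD[OF AS] uv] by blast
qed

text \<open>By Green's identity \<open>J T a\<close> is orthogonal to all traces, and the trace is surjective.\<close>

lemma trace_zero_on_domain:
  assumes "extension P S" "(a, b) \<in> A"
  shows "T a = 0"
proof -
  have ab: "(a, b) \<in> op_adjoint A"
    using extension_subset_adjoint[OF assms(1)] assms unfolding lagrangian_extension_def by blast
  obtain v where "v \<in> hplus A" and v: "T v = sympl_J (T a)"
    using triplet unfolding boundary_triplet_def by (metis UNIV_I imageE)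
  then obtain v' where v': "(v, v') \<in> op_adjoint A"
    by (auto simp: hplus_def)
  then have "cinner b v = cinner a v'"
    using assms(2) unfolding op_adjoint_def by blast
  then have "cinner (sympl_J (T a)) (sympl_J (T a)) = 0"
    using Green[OF ab v'] v by simp
  then show ?thesis
    by (simp add: cinner_self)
qed

lemma extension_trace_in_plane:
  assumes "extension P S" "(u, v) \<in> S"
  shows "P (T u) = T u" "T u \<in> range P"
proof -
  show "T u \<in> range P"
    using assms unfolding lagrangian_extension_def by blast
  then show "P (T u) = T u"
    using assms unfolding lagrangian_extension_def orthogonal_projection_def by fastforce
qed

lemma extension_isotropic:
  assumes "extension P S" "x \<in> range P" "y \<in> range P"
  shows "cinner (sympl_J x) y = 0"
  using assms unfolding lagrangian_extension_def lagrangian_def sympl_form_eq_cinner_J by blast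

lemma projection_sympl_J_eq_0:
  assumes "extension P S" "x \<in> range P"
  shows "P (sympl_J x) = 0"
proof -
  have P: "P (P y) = P y" "cinner (P y) z = cinner y (P z)" for y z
    using assms unfolding lagrangian_extension_def orthogonal_projection_def by blast+
  have "cinner (P (sympl_J x)) (P (sympl_J x)) = cinner (sympl_J x) (P (sympl_J x))"
    by (simp add: P)
  also have "\<dots> = 0"
    using extension_isotropic[OF assms] by blast
  finally show ?thesis
    by (simp add: cinner_self)
qed

lemma extension_self_adjoint: "extension P S \<Longrightarrow> self_adjoint_op S"
  by (simp add: lagrangian_extension_def)

lemma resolvent_in_adjoint:
  assumes "extension P S" "\<zeta> \<notin> Spec S"
  shows "(resolvent S \<zeta> f, f + \<zeta> *\<^sub>C resolvent S \<zeta> f) \<in> op_adjoint A"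
  using extension_subset_adjoint[OF assms(1)] resolvent_in[OF assms(2)] by blast

lemma trace_resolvent_bounded_clinear:
  assumes "extension P S" "\<zeta> \<notin> Spec S"
  shows "bounded_clinear (\<lambda>f. T (resolvent S \<zeta> f))"
  using bounded_clinear_resolvent[OF assms(2)]
  by (intro trace_bounded_clinear[where F' = "\<lambda>f. f + \<zeta> *\<^sub>C resolvent S \<zeta> f"]
      bounded_clinear_plus bounded_clinear_ident bounded_clinear_scaleC_fun resolvent_in_adjoint[OF assms])

lemma norm_trace_resolvent_le:
  assumes S: "extension P S" "\<zeta> \<notin> Spec S"
    and M: "bounded_below_at S \<zeta> M" "0 \<le> M" and Z: "cmod \<zeta> \<le> Z"
  shows "norm (T (resolvent S \<zeta> f)) \<le> K * (1 + (1 + Z) * M) * norm f"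
proof -
  have R: "norm (resolvent S \<zeta> f) \<le> M * norm f"
    by (rule norm_resolvent_le[OF S(2) M(1)])
  have "norm (f + \<zeta> *\<^sub>C resolvent S \<zeta> f) \<le> norm f + cmod \<zeta> * norm (resolvent S \<zeta> f)"
    using norm_triangle_ineq by (metis norm_scaleC)
  also have "cmod \<zeta> * norm (resolvent S \<zeta> f) \<le> Z * (M * norm f)"
    using R Z by (intro mult_mono) (auto intro: order_trans[OF norm_ge_zero])
  finally have "norm (resolvent S \<zeta> f) + norm (f + \<zeta> *\<^sub>C resolvent S \<zeta> f) \<le> (1 + (1 + Z) * M) * norm f"
    using R by (simp add: algebra_simps)
  then have "K * (norm (resolvent S \<zeta> f) + norm (f + \<zeta> *\<^sub>C resolvent S \<zeta> f)) \<le> K * ((1 + (1 + Z) * M) * norm f)"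
    using K_nonneg by (rule mult_left_mono)
  then show ?thesis
    using norm_trace_le[OF resolvent_in_adjoint[OF S], of f] by (simp add: mult.assoc)
qed

text \<open>On the kernel of the shifted adjoint the graph norm and the norm are equivalent. This is what
  upgrades estimates in the Hilbert space to estimates of traces and of graph norms.\<close>

lemma kernel_bounds:
  assumes "(w, \<zeta> *\<^sub>C w) \<in> op_adjoint A" "cmod \<zeta> \<le> Z"
  shows hplus_norm_kernel_le: "hplus_norm A w \<le> (1 + Z) * norm w"
    and norm_trace_kernel_le: "norm (T w) \<le> K * (1 + Z) * norm w"
proof -
  have "norm w + norm (\<zeta> *\<^sub>C w) \<le> (1 + Z) * norm w"
    using mult_right_mono[OF assms(2) norm_ge_zero[of w]] by (simp add: norm_scaleC distrib_right)
  then show "hplus_norm A w \<le> (1 + Z) * norm w" "norm (T w) \<le> K * (1 + Z) * norm w"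
    using hplus_norm_le[OF assms(1)] norm_trace_le[OF assms(1)] mult_left_mono[OF _ K_nonneg]
    by (fastforce simp: mult.assoc)+
qed

text \<open>Pairing with a vector of \<open>(A - \<eta>) (dom A)\<close> reduces to the trace of a vector of
  \<open>dom A\<close>, which vanishes.\<close>

lemma adjoint_trace_resolvent_in_kernel:
  fixes \<eta> S
  defines "G \<equiv> hilbert_adjoint (\<lambda>g. T (resolvent S \<eta> g))"
  assumes S: "extension P S" "\<eta> \<notin> Spec S"
  shows "(G y, cnj \<eta> *\<^sub>C G y) \<in> op_adjoint A"
  unfolding op_adjoint_def
proof clarify
  fix a b assume ab: "(a, b) \<in> A"
  have "(a, (b - \<eta> *\<^sub>C a) + \<eta> *\<^sub>C a) \<in> S"
    using ab S(1) by (auto simp: lagrangian_extension_def)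
  then have "resolvent S \<eta> (b - \<eta> *\<^sub>C a) = a"
    by (rule resolvent_unique[OF S(2)])
  then have "cinner (b - \<eta> *\<^sub>C a) (G y) = cinner (T a) y"
    unfolding G_def by (simp flip: cinner_hilbert_adjoint[OF trace_resolvent_bounded_clinear[OF S]])
  then show "cinner b (G y) = cinner a (cnj \<eta> *\<^sub>C G y)"
    by (simp add: trace_zero_on_domain[OF S(1) ab] cinner_simps)
qed

lemma adjoint_trace_resolvent_into_hplus:
  assumes S: "extension P S" "\<eta> \<notin> Spec S" and L: "bounded_clinear L"
  shows "bounded_into_hplus A (\<lambda>f. hilbert_adjoint (\<lambda>g. T (resolvent S \<eta> g)) (L f))"
  by (intro bounded_into_hplusI[where F' = "\<lambda>f. cnj \<eta> *\<^sub>C hilbert_adjoint (\<lambda>g. T (resolvent S \<eta> g)) (L f)"]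
      bounded_clinear_scaleC_fun bounded_clinear_compose[OF bounded_clinear_hilbert_adjoint L]
      trace_resolvent_bounded_clinear[OF S] adjoint_trace_resolvent_in_kernel[OF S])

section \<open>Comparing two extensions\<close>

text \<open>Krein's formula: Green's identity for \<open>u = R0 f\<close> and \<open>v = R g\<close> expresses the difference of
  the resolvents by the boundary form, and isotropy of the two planes lets the projections in.\<close>

lemma Krein_formula:
  assumes S: "extension P S" "\<zeta> \<notin> Spec S" and S0: "extension P0 S0" "\<zeta> \<notin> Spec S0"
  defines "a f \<equiv> sympl_J (T (resolvent S0 \<zeta> f))"
  shows "cinner (resolvent S \<zeta> f - resolvent S0 \<zeta> f) g =
    cinner (P (a f) - P0 (a f)) (T (resolvent S (cnj \<zeta>) g))"
proof -
  define u where "u = resolvent S0 \<zeta> f"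
  define v where "v = resolvent S (cnj \<zeta>) g"
  have cnj: "cnj \<zeta> \<notin> Spec S"
    using S extension_self_adjoint cnj_not_Spec by blast
  have u: "(u, f + \<zeta> *\<^sub>C u) \<in> S0"
    unfolding u_def by (rule resolvent_in[OF S0(2)])
  have v: "(v, g + cnj \<zeta> *\<^sub>C v) \<in> S"
    unfolding v_def by (rule resolvent_in[OF cnj])
  have "cinner (f + \<zeta> *\<^sub>C u) v - cinner u (g + cnj \<zeta> *\<^sub>C v) = cinner (a f) (T v)"
    using Green u v extension_subset_adjoint[OF S(1)] extension_subset_adjoint[OF S0(1)]
    unfolding a_def u_def[symmetric] by blast
  then have "cinner f v - cinner u g = cinner (a f) (P (T v))"
    by (simp add: cinner_simps extension_trace_in_plane[OF S(1) v])
  also have "\<dots> = cinner (P (a f)) (T v)"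
    using S(1) unfolding lagrangian_extension_def orthogonal_projection_def by metis
  also have "P0 (a f) = 0"
    unfolding a_def u_def[symmetric]
    by (intro projection_sympl_J_eq_0[OF S0(1)] extension_trace_in_plane[OF S0(1) u])
  then have "cinner (P (a f)) (T v) = cinner (P (a f) - P0 (a f)) (T v)"
    by simp
  finally show ?thesis
    using cinner_resolvent[OF extension_self_adjoint[OF S(1)] S(2), of f g]
    by (simp add: cinner_diff_left[of "resolvent S \<zeta> f"] flip: u_def v_def)
qed

text \<open>For \<open>u\<close> in the domain of \<open>S\<close> and \<open>f = (S - \<zeta>) u\<close>, the difference \<open>w = u - R0 f\<close> lies in
  the kernel of the shifted adjoint, and Green's identity against \<open>R0 (cnj \<zeta>) g\<close> bounds \<open>w\<close> by the
  gap \<open>\<delta>\<close> times the graph norm of \<open>u\<close>, which can be absorbed.\<close>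

lemma bounded_below_at_near_extension:
  assumes S: "extension P S" and S0: "extension P0 S0"
    and M: "bounded_below_at S0 \<zeta> M" "0 \<le> M" and Z: "cmod \<zeta> \<le> Z"
    and \<delta>: "\<And>x. norm (P x - P0 x) \<le> \<delta> * norm x" "0 \<le> \<delta>"
    and small: "\<delta> * (K * (1 + (1 + Z) * M)) * K * (1 + Z) \<le> 1 / 2"
  shows "bounded_below_at S \<zeta> (2 * M + 1)"
  unfolding bounded_below_at_def
proof clarify
  fix u u' assume uu': "(u, u') \<in> S"
  define C where "C = K * (1 + (1 + Z) * M)"
  have Z0: "0 \<le> Z"
    using Z norm_ge_zero order_trans by blast
  have C0: "0 \<le> C"
    unfolding C_def using K_nonneg M Z0 by simp
  have sa: "self_adjoint_op S0"
    by (rule extension_self_adjoint[OF S0])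
  have \<zeta>: "\<zeta> \<notin> Spec S0"
    using not_Spec_iff_bounded_below[OF sa] M by blast
  then have \<zeta>': "cnj \<zeta> \<notin> Spec S0"
    by (rule cnj_not_Spec[OF sa])
  have M': "bounded_below_at S0 (cnj \<zeta>) M"
    using M by (simp add: bounded_below_at_cnj[OF sa])
  define f where "f = u' - \<zeta> *\<^sub>C u"
  define u0 where "u0 = resolvent S0 \<zeta> f"
  have u: "(u, f + \<zeta> *\<^sub>C u) \<in> S"
    using uu' by (simp add: f_def)
  have u0: "(u0, f + \<zeta> *\<^sub>C u0) \<in> S0"
    unfolding u0_def by (rule resolvent_in[OF \<zeta>])
  have uA: "(u, f + \<zeta> *\<^sub>C u) \<in> op_adjoint A" and u0A: "(u0, f + \<zeta> *\<^sub>C u0) \<in> op_adjoint A"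
    using u u0 extension_subset_adjoint[OF S] extension_subset_adjoint[OF S0] by auto
  have w: "(u - u0, \<zeta> *\<^sub>C (u - u0)) \<in> op_adjoint A"
    using adjoint_diff[OF uA u0A] by (simp add: complex_vector.scale_right_diff_distrib)
  have "norm (u - u0) \<le> \<delta> * norm (T u) * C"
  proof (rule norm_le_if_cinner_le)
    fix g
    define v where "v = resolvent S0 (cnj \<zeta>) g"
    have v: "(v, g + cnj \<zeta> *\<^sub>C v) \<in> S0"
      unfolding v_def by (rule resolvent_in[OF \<zeta>'])
    then have vA: "(v, g + cnj \<zeta> *\<^sub>C v) \<in> op_adjoint A"
      using extension_subset_adjoint[OF S0] by auto
    have iso: "cinner (sympl_J x) (T v) = 0" if "x \<in> range P0" for x
      using extension_isotropic[OF S0 that] extension_trace_in_plane[OF S0 v] by blast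
    have "- cinner (u - u0) g = cinner (sympl_J (T u - T u0)) (T v)"
      using Green[OF w vA] trace_diff[OF uA u0A] by (simp add: cinner_simps algebra_simps)
    also have "\<dots> = cinner (sympl_J (T u)) (T v) - cinner (sympl_J (T u0)) (T v)"
      by (simp add: bounded_clinear_diff[OF bounded_clinear_sympl_J] cinner_diff_left)
    also have "cinner (sympl_J (T u0)) (T v) = cinner (sympl_J (P0 (T u))) (T v)"
      using iso extension_trace_in_plane[OF S0 u0] by simp
    also have "cinner (sympl_J (T u)) (T v) - \<dots> = cinner (sympl_J (P (T u) - P0 (T u))) (T v)"
      by (simp add: bounded_clinear_diff[OF bounded_clinear_sympl_J] cinner_diff_left
          extension_trace_in_plane[OF S u])
    finally have "cmod (cinner (u - u0) g) = cmod (cinner (sympl_J (P (T u) - P0 (T u))) (T v))"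
      by (metis norm_minus_cancel)
    also have "\<dots> \<le> norm (P (T u) - P0 (T u)) * norm (T v)"
      using cinner_Cauchy_Schwarz[of "sympl_J (P (T u) - P0 (T u))"] by simp
    also have "\<dots> \<le> (\<delta> * norm (T u)) * (C * norm g)"
      unfolding v_def C_def using Z \<delta>(2)
      by (intro mult_mono \<delta> norm_trace_resolvent_le[OF S0 \<zeta>' M' M(2)]) auto
    finally show "cmod (cinner (u - u0) g) \<le> \<delta> * norm (T u) * C * norm g"
      by (simp add: mult_ac)
  qed (simp add: \<delta> C0)
  also have "\<dots> \<le> \<delta> * (K * ((1 + Z) * (norm u + norm f))) * C"
  proof (intro mult_right_mono mult_left_mono \<delta>(2) C0)
    have "norm (f + \<zeta> *\<^sub>C u) \<le> norm f + Z * norm u"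
      using norm_triangle_ineq[of f "\<zeta> *\<^sub>C u"] mult_right_mono[OF Z norm_ge_zero[of u]]
      by (simp add: norm_scaleC)
    then have "norm u + norm (f + \<zeta> *\<^sub>C u) \<le> (1 + Z) * (norm u + norm f)"
      using mult_nonneg_nonneg[OF Z0 norm_ge_zero[of f]] by (simp add: algebra_simps)
    then show "norm (T u) \<le> K * ((1 + Z) * (norm u + norm f))"
      using norm_trace_le[OF uA] K_nonneg by (meson mult_left_mono order_trans)
  qed
  also have "\<dots> = (\<delta> * C * K * (1 + Z)) * (norm u + norm f)"
    by (simp add: mult_ac)
  also have "\<dots> \<le> 1 / 2 * (norm u + norm f)"
    using small unfolding C_def by (rule mult_right_mono) simp
  finally have "norm (u - u0) \<le> 1 / 2 * (norm u + norm f)" .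
  moreover have "norm u0 \<le> M * norm f"
    unfolding u0_def by (rule norm_resolvent_le[OF \<zeta> M(1)])
  moreover have "norm u \<le> norm (u - u0) + norm u0"
    using norm_triangle_ineq[of "u - u0" u0] by simp
  ultimately show "norm u \<le> (2 * M + 1) * norm (u' - \<zeta> *\<^sub>C u)"
    unfolding f_def[symmetric] by (simp add: algebra_simps)
qed

end

section \<open>Expansion of the resolvent\<close>

context boundary_trace
begin

context
  fixes P0 S0 \<zeta>
  assumes S0: "extension P0 S0" and \<zeta>: "\<zeta> \<notin> Spec S0"
begin

lemma cnj_not_Spec_S0: "cnj \<zeta> \<notin> Spec S0"
  by (rule cnj_not_Spec[OF extension_self_adjoint[OF S0] \<zeta>])

lemma bounded_clinear_sympl_J_trace: "bounded_clinear (\<lambda>f. sympl_J (T (resolvent S0 \<zeta> f)))"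
  by (intro bounded_clinear_compose[OF bounded_clinear_sympl_J]
      trace_resolvent_bounded_clinear[OF S0 \<zeta>])

context
  fixes Q1 :: "'k \<times> 'k \<Rightarrow> 'k \<times> 'k"
  assumes Q1: "bounded_clinear Q1"
begin

lemma cinner_resolvent_dot:
  "cinner (resolvent_dot T S0 Q1 \<zeta> f) g =
     cinner (Q1 (sympl_J (T (resolvent S0 \<zeta> f)))) (T (resolvent S0 (cnj \<zeta>) g))"
  unfolding resolvent_dot_def
  by (rule cinner_hilbert_adjoint_left[OF trace_resolvent_bounded_clinear[OF S0 cnj_not_Spec_S0]])

lemma bounded_clinear_resolvent_dot: "bounded_clinear (resolvent_dot T S0 Q1 \<zeta>)"
  unfolding resolvent_dot_def
  by (intro bounded_clinear_compose[OF bounded_clinear_hilbert_adjoint]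
      bounded_clinear_compose[OF Q1] bounded_clinear_sympl_J_trace
      trace_resolvent_bounded_clinear[OF S0 cnj_not_Spec_S0])

lemma resolvent_dot_in_kernel:
  "(resolvent_dot T S0 Q1 \<zeta> f, \<zeta> *\<^sub>C resolvent_dot T S0 Q1 \<zeta> f) \<in> op_adjoint A"
  unfolding resolvent_dot_def
  using adjoint_trace_resolvent_in_kernel[OF S0 cnj_not_Spec_S0] by simp

lemma resolvent_dot_into_hplus: "bounded_into_hplus A (resolvent_dot T S0 Q1 \<zeta>)"
  by (rule bounded_into_hplusI[OF bounded_clinear_resolvent_dot
        bounded_clinear_scaleC_fun[OF bounded_clinear_resolvent_dot] resolvent_dot_in_kernel])

lemma trace_resolvent_dot_bounded_clinear: "bounded_clinear (\<lambda>f. T (resolvent_dot T S0 Q1 \<zeta> f))"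
  by (rule trace_bounded_clinear[OF bounded_clinear_resolvent_dot
        bounded_clinear_scaleC_fun[OF bounded_clinear_resolvent_dot] resolvent_dot_in_kernel])

text \<open>The inhomogeneous terms \<open>f\<close> in the images of the two resolvents under the adjoint cancel.\<close>

lemma first_remainder_in_kernel:
  fixes s :: real
  assumes "extension P S" "\<zeta> \<notin> Spec S"
  defines "r f \<equiv> resolvent S \<zeta> f - (resolvent S0 \<zeta> f + s *\<^sub>R resolvent_dot T S0 Q1 \<zeta> f)"
  shows "(r f, \<zeta> *\<^sub>C r f) \<in> op_adjoint A" and "bounded_clinear r"
proof -
  have "(r f, (f + \<zeta> *\<^sub>C resolvent S \<zeta> f) - ((f + \<zeta> *\<^sub>C resolvent S0 \<zeta> f) +
      complex_of_real s *\<^sub>C \<zeta> *\<^sub>C resolvent_dot T S0 Q1 \<zeta> f)) \<in> op_adjoint A"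
    unfolding r_def scaleR_scaleC
    by (intro adjoint_diff adjoint_add adjoint_scaleC resolvent_in_adjoint[OF assms(1,2)]
        resolvent_in_adjoint[OF S0 \<zeta>] resolvent_dot_in_kernel)
  then show "(r f, \<zeta> *\<^sub>C r f) \<in> op_adjoint A"
    by (simp add: r_def scaleR_scaleC scaleC_scaleC complex_vector.scale_right_diff_distrib
        scaleC_add_right mult.commute)
  show "bounded_clinear r"
    unfolding r_def
    by (intro bounded_clinear_minus bounded_clinear_plus bounded_clinear_scaleR_fun
        bounded_clinear_resolvent bounded_clinear_resolvent_dot assms \<zeta>)
qed

end

end

lemma resolvent_difference_in_kernel:
  assumes "extension P S" "\<zeta> \<notin> Spec S" "extension P0 S0" "\<zeta> \<notin> Spec S0"
  defines "d f \<equiv> resolvent S \<zeta> f - resolvent S0 \<zeta> f"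
  shows "(d f, \<zeta> *\<^sub>C d f) \<in> op_adjoint A"
  using adjoint_diff[OF resolvent_in_adjoint[OF assms(1,2)] resolvent_in_adjoint[OF assms(3,4)], of f f]
  by (simp add: d_def complex_vector.scale_right_diff_distrib)

lemma
  assumes S0: "extension P0 S0" "\<zeta> \<notin> Spec S0"
    and Q1: "bounded_clinear Q1" and Q2: "bounded_clinear Q2"
  defines "a f \<equiv> sympl_J (T (resolvent S0 \<zeta> f))"
  shows cinner_resolvent_ddot: "\<And>f g. cinner (resolvent_ddot T S0 Q1 Q2 \<zeta> f) g =
      cinner (Q2 (a f)) (T (resolvent S0 (cnj \<zeta>) g)) +
      2 * cinner (Q1 (a f)) (T (resolvent_dot T S0 Q1 (cnj \<zeta>) g))"
    and bounded_clinear_resolvent_ddot: "bounded_clinear (resolvent_ddot T S0 Q1 Q2 \<zeta>)"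
proof -
  note cnj = cnj_not_Spec_S0[OF S0]
  note b0 = trace_resolvent_bounded_clinear[OF S0(1) cnj]
  note b1 = trace_resolvent_dot_bounded_clinear[OF S0(1) cnj Q1]
  show "cinner (resolvent_ddot T S0 Q1 Q2 \<zeta> f) g =
      cinner (Q2 (a f)) (T (resolvent S0 (cnj \<zeta>) g)) +
      2 * cinner (Q1 (a f)) (T (resolvent_dot T S0 Q1 (cnj \<zeta>) g))" for f g
    unfolding resolvent_ddot_def a_def cinner_add_left cinner_scaleR_left
    by (simp add: cinner_hilbert_adjoint_left[OF b0] cinner_hilbert_adjoint_left[OF b1])
  show "bounded_clinear (resolvent_ddot T S0 Q1 Q2 \<zeta>)"
    unfolding resolvent_ddot_def
    by (intro bounded_clinear_plus bounded_clinear_scaleR_fun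
        bounded_clinear_compose[OF bounded_clinear_hilbert_adjoint] b0 b1
        bounded_clinear_compose[OF Q1] bounded_clinear_compose[OF Q2]
        bounded_clinear_sympl_J_trace[OF S0])
qed

text \<open>The quantitative comparison of two extensions whose projections differ by
  \<open>s *\<^sub>R Q1\<close> up to second order; \<open>s\<close> plays the role of \<open>t - t0\<close>.\<close>

context
  fixes P S P0 S0 and Q1 :: "'k \<times> 'k \<Rightarrow> 'k \<times> 'k" and \<zeta> :: complex and M Z C c s :: real
  assumes S: "extension P S" and S0: "extension P0 S0" and Q1: "bounded_clinear Q1"
    and M: "bounded_below_at S \<zeta> M" "bounded_below_at S0 \<zeta> M" "0 \<le> M"
    and Z: "cmod \<zeta> \<le> Z" and C: "C = K * (1 + (1 + Z) * M)"
    and c: "0 \<le> c" "\<And>x. norm (Q1 x) \<le> c * norm x"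
      "\<And>x. norm (P x - P0 x) \<le> c * \<bar>s\<bar> * norm x"
      "\<And>x. norm (P x - (P0 x + s *\<^sub>R Q1 x)) \<le> c * s\<^sup>2 * norm x"
begin

lemma not_Spec: "\<zeta> \<notin> Spec S" "\<zeta> \<notin> Spec S0"
  using M not_Spec_iff_bounded_below extension_self_adjoint S S0 by blast+

lemma constants_nonneg: "0 \<le> Z" "0 \<le> C"
proof -
  show "0 \<le> Z"
    using Z norm_ge_zero order_trans by blast
  then show "0 \<le> C"
    using C K_nonneg M by simp
qed

lemma trace_resolvent_bounds:
  "norm (T (resolvent S \<zeta> f)) \<le> C * norm f"
  "norm (T (resolvent S0 \<zeta> f)) \<le> C * norm f"
  "norm (T (resolvent S (cnj \<zeta>) f)) \<le> C * norm f"
  "norm (T (resolvent S0 (cnj \<zeta>) f)) \<le> C * norm f"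
proof -
  have "bounded_below_at S (cnj \<zeta>) M" "bounded_below_at S0 (cnj \<zeta>) M"
    using M bounded_below_at_cnj extension_self_adjoint S S0 by blast+
  moreover have "cnj \<zeta> \<notin> Spec S" "cnj \<zeta> \<notin> Spec S0"
    using not_Spec cnj_not_Spec extension_self_adjoint S S0 by blast+
  ultimately show
    "norm (T (resolvent S \<zeta> f)) \<le> C * norm f"
    "norm (T (resolvent S0 \<zeta> f)) \<le> C * norm f"
    "norm (T (resolvent S (cnj \<zeta>) f)) \<le> C * norm f"
    "norm (T (resolvent S0 (cnj \<zeta>) f)) \<le> C * norm f"
    unfolding C using not_Spec M Z by (auto intro!: norm_trace_resolvent_le S S0)
qed

lemma cinner_le_product:
  fixes x y :: "'k \<times> 'k" and f g :: 'h
  assumes "norm x \<le> p * (C * norm f)" "norm y \<le> q * norm g" "0 \<le> p"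
  shows "cmod (cinner x y) \<le> p * C * q * norm f * norm g"
proof -
  have "cmod (cinner x y) \<le> norm x * norm y"
    by (rule cinner_Cauchy_Schwarz)
  also have "\<dots> \<le> (p * (C * norm f)) * (q * norm g)"
    using assms constants_nonneg by (intro mult_mono) auto
  finally show ?thesis
    by (simp add: mult_ac)
qed

lemma norm_compose_sympl_J_trace_le:
  fixes L :: "'k \<times> 'k \<Rightarrow> 'k \<times> 'k"
  assumes "\<And>x. norm (L x) \<le> p * norm x" "0 \<le> p"
  shows "norm (L (sympl_J (T (resolvent S0 \<zeta> f)))) \<le> p * (C * norm f)"
  using assms(1)[of "sympl_J (T (resolvent S0 \<zeta> f))"]
    mult_left_mono[OF trace_resolvent_bounds(2)[of f] assms(2)] by simp

lemma resolvent_difference_le: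
  "norm (resolvent S \<zeta> f - resolvent S0 \<zeta> f) \<le> c * C\<^sup>2 * \<bar>s\<bar> * norm f"
proof (rule norm_le_if_cinner_le)
  fix g
  have "cmod (cinner (resolvent S \<zeta> f - resolvent S0 \<zeta> f) g) \<le> (c * \<bar>s\<bar>) * C * C * norm f * norm g"
    unfolding Krein_formula[OF S not_Spec(1) S0 not_Spec(2)]
    by (intro cinner_le_product norm_compose_sympl_J_trace_le[where L = "\<lambda>x. P x - P0 x"]
        trace_resolvent_bounds c) (simp_all add: c)
  then show "cmod (cinner (resolvent S \<zeta> f - resolvent S0 \<zeta> f) g) \<le> c * C\<^sup>2 * \<bar>s\<bar> * norm f * norm g"
    by (simp add: power2_eq_square mult_ac)
qed (simp add: c constants_nonneg)

end

text \<open>In the next two estimates the differences of traces of resolvents at \<open>cnj \<zeta>\<close> gain one power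
  of \<open>s\<close> from the preceding order: they are traces of vectors in the kernel of the shifted adjoint,
  on which the trace is bounded by the norm of \<open>'h\<close>.\<close>

lemma first_remainder_le:
  assumes S: "extension P S" and S0: "extension P0 S0" and Q1: "bounded_clinear Q1"
    and M: "bounded_below_at S \<zeta> M" "bounded_below_at S0 \<zeta> M" "0 \<le> M"
    and Z: "cmod \<zeta> \<le> Z" and C: "C = K * (1 + (1 + Z) * M)"
    and c: "0 \<le> c" "\<And>x. norm (Q1 x) \<le> c * norm x"
      "\<And>x. norm (P x - P0 x) \<le> c * \<bar>s\<bar> * norm x"
      "\<And>x. norm (P x - (P0 x + s *\<^sub>R Q1 x)) \<le> c * s\<^sup>2 * norm x"
  shows "norm (resolvent S \<zeta> f - (resolvent S0 \<zeta> f + s *\<^sub>R resolvent_dot T S0 Q1 \<zeta> f))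
    \<le> (c * C\<^sup>2 + c\<^sup>2 * C ^ 3 * (K * (1 + Z))) * s\<^sup>2 * norm f" (is "norm ?r \<le> _")
proof (rule norm_le_if_cinner_le)
  note ctx = S S0 Q1 M Z C c
  note spec = not_Spec[OF ctx] and nn = constants_nonneg[OF ctx]
  have ctx': "bounded_below_at S (cnj \<zeta>) M" "bounded_below_at S0 (cnj \<zeta>) M" "cmod (cnj \<zeta>) \<le> Z"
    using M Z by (simp_all add: bounded_below_at_cnj extension_self_adjoint[OF S] extension_self_adjoint[OF S0])
  note spec' = not_Spec[OF S S0 Q1 ctx'(1,2) M(3) ctx'(3) C c]
  show "0 \<le> (c * C\<^sup>2 + c\<^sup>2 * C ^ 3 * (K * (1 + Z))) * s\<^sup>2 * norm f"
    using nn c K_nonneg by simp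
  fix g
  define a where "a = sympl_J (T (resolvent S0 \<zeta> f))"
  define b where "b = T (resolvent S (cnj \<zeta>) g)"
  define b0 where "b0 = T (resolvent S0 (cnj \<zeta>) g)"
  have diff: "b - b0 = T (resolvent S (cnj \<zeta>) g - resolvent S0 (cnj \<zeta>) g)"
    unfolding b_def b0_def
    by (rule trace_diff[symmetric, OF resolvent_in_adjoint[OF S spec'(1)] resolvent_in_adjoint[OF S0 spec'(2)]])
  have "norm (b - b0) \<le> K * (1 + Z) * norm (resolvent S (cnj \<zeta>) g - resolvent S0 (cnj \<zeta>) g)"
    unfolding diff
    by (rule norm_trace_kernel_le[OF resolvent_difference_in_kernel[OF S spec'(1) S0 spec'(2)] ctx'(3)])
  also have "\<dots> \<le> K * (1 + Z) * (c * C\<^sup>2 * \<bar>s\<bar> * norm g)"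
    using K_nonneg nn
    by (intro mult_left_mono resolvent_difference_le[OF S S0 Q1 ctx'(1,2) M(3) ctx'(3) C c]) simp
  finally have bb: "norm (b - b0) \<le> K * (1 + Z) * c * C\<^sup>2 * \<bar>s\<bar> * norm g"
    by (simp add: mult_ac)
  have "cinner ?r g = cinner (P a - P0 a) b - of_real s * cinner (Q1 a) b0"
    using Krein_formula[OF S spec(1) S0 spec(2), of f g]
    by (simp add: cinner_simps cinner_resolvent_dot[OF S0 spec(2) Q1] a_def b_def b0_def algebra_simps)
  also have "\<dots> = cinner (P a - (P0 a + s *\<^sub>R Q1 a)) b + of_real s * cinner (Q1 a) (b - b0)"
    by (simp add: cinner_simps algebra_simps)
  finally have "cmod (cinner ?r g) \<le>
      cmod (cinner (P a - (P0 a + s *\<^sub>R Q1 a)) b) + \<bar>s\<bar> * cmod (cinner (Q1 a) (b - b0))"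
    by (metis norm_triangle_ineq norm_mult norm_of_real)
  also have "\<dots> \<le> (c * s\<^sup>2) * C * C * norm f * norm g +
      \<bar>s\<bar> * (c * C * (K * (1 + Z) * c * C\<^sup>2 * \<bar>s\<bar>) * norm f * norm g)"
    unfolding a_def
    by (intro add_mono mult_left_mono cinner_le_product[OF ctx]
        norm_compose_sympl_J_trace_le[OF ctx, where L = "\<lambda>x. P x - (P0 x + s *\<^sub>R Q1 x)"]
        norm_compose_sympl_J_trace_le[OF ctx, where L = Q1] bb
        trace_resolvent_bounds[OF ctx, folded b_def] c) (simp_all add: c b_def trace_resolvent_bounds[OF ctx])
  also have "\<dots> = (c * C\<^sup>2 + c\<^sup>2 * C ^ 3 * (K * (1 + Z))) * s\<^sup>2 * norm f * norm g"
    by (simp add: power2_eq_square power3_eq_cube algebra_simps)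
  finally show "cmod (cinner ?r g) \<le>
      (c * C\<^sup>2 + c\<^sup>2 * C ^ 3 * (K * (1 + Z))) * s\<^sup>2 * norm f * norm g" .
qed

lemma second_remainder_le:
  assumes S: "extension P S" and S0: "extension P0 S0"
    and Q1: "bounded_clinear Q1" and Q2: "bounded_clinear Q2"
    and M: "bounded_below_at S \<zeta> M" "bounded_below_at S0 \<zeta> M" "0 \<le> M"
    and Z: "cmod \<zeta> \<le> Z" and C: "C = K * (1 + (1 + Z) * M)"
    and c: "0 \<le> c" "\<And>x. norm (Q1 x) \<le> c * norm x"
      "\<And>x. norm (P x - P0 x) \<le> c * \<bar>s\<bar> * norm x"
      "\<And>x. norm (P x - (P0 x + s *\<^sub>R Q1 x)) \<le> c * s\<^sup>2 * norm x"
    and c2: "\<And>x. norm (Q2 x) \<le> c * norm x"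
    and e: "\<And>x. norm (P x - (P0 x + s *\<^sub>R Q1 x + (s\<^sup>2 / 2) *\<^sub>R Q2 x)) \<le> e * s\<^sup>2 * norm x" "0 \<le> e"
    and L: "L = K * (1 + Z)" and E: "E = c * C\<^sup>2 + c\<^sup>2 * C ^ 3 * L"
  shows "norm (resolvent S \<zeta> f - (resolvent S0 \<zeta> f + s *\<^sub>R resolvent_dot T S0 Q1 \<zeta> f
      + (s\<^sup>2 / 2) *\<^sub>R resolvent_ddot T S0 Q1 Q2 \<zeta> f))
    \<le> (e * C\<^sup>2 + \<bar>s\<bar> * (c * C * L * E + c\<^sup>2 * C ^ 3 * L)) * s\<^sup>2 * norm f" (is "norm ?r \<le> _")
proof (rule norm_le_if_cinner_le)
  note ctx = S S0 Q1 M Z C c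
  note spec = not_Spec[OF ctx] and nn = constants_nonneg[OF ctx]
  have ctx': "bounded_below_at S (cnj \<zeta>) M" "bounded_below_at S0 (cnj \<zeta>) M" "cmod (cnj \<zeta>) \<le> Z"
    using M Z by (simp_all add: bounded_below_at_cnj extension_self_adjoint[OF S] extension_self_adjoint[OF S0])
  note spec' = not_Spec[OF S S0 Q1 ctx'(1,2) M(3) ctx'(3) C c]
  have L0: "0 \<le> L" and E0: "0 \<le> E"
    unfolding E L using nn c K_nonneg by simp_all
  show "0 \<le> (e * C\<^sup>2 + \<bar>s\<bar> * (c * C * L * E + c\<^sup>2 * C ^ 3 * L)) * s\<^sup>2 * norm f"
    using nn c L0 E0 e by simp
  fix g
  define a where "a = sympl_J (T (resolvent S0 \<zeta> f))"
  define b where "b = T (resolvent S (cnj \<zeta>) g)"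
  define b0 where "b0 = T (resolvent S0 (cnj \<zeta>) g)"
  define b1 where "b1 = T (resolvent_dot T S0 Q1 (cnj \<zeta>) g)"
  have diff: "b - b0 = T (resolvent S (cnj \<zeta>) g - resolvent S0 (cnj \<zeta>) g)"
    unfolding b_def b0_def
    by (rule trace_diff[symmetric, OF resolvent_in_adjoint[OF S spec'(1)] resolvent_in_adjoint[OF S0 spec'(2)]])
  have "norm (b - b0) \<le> L * norm (resolvent S (cnj \<zeta>) g - resolvent S0 (cnj \<zeta>) g)"
    unfolding diff L
    by (rule norm_trace_kernel_le[OF resolvent_difference_in_kernel[OF S spec'(1) S0 spec'(2)] ctx'(3)])
  also have "\<dots> \<le> L * (c * C\<^sup>2 * \<bar>s\<bar> * norm g)"
    by (intro mult_left_mono resolvent_difference_le[OF S S0 Q1 ctx'(1,2) M(3) ctx'(3) C c] L0)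
  finally have bb: "norm (b - b0) \<le> L * c * C\<^sup>2 * \<bar>s\<bar> * norm g"
    by (simp add: mult_ac)
  define r1 where "r1 = resolvent S (cnj \<zeta>) g -
      (resolvent S0 (cnj \<zeta>) g + s *\<^sub>R resolvent_dot T S0 Q1 (cnj \<zeta>) g)"
  note dot = resolvent_dot_in_kernel[OF S0 spec'(2) Q1, of g]
  have "T r1 = T (resolvent S (cnj \<zeta>) g) -
      T (resolvent S0 (cnj \<zeta>) g + s *\<^sub>R resolvent_dot T S0 Q1 (cnj \<zeta>) g)"
    unfolding r1_def scaleR_scaleC
    by (rule trace_diff[OF resolvent_in_adjoint[OF S spec'(1)]
          adjoint_add[OF resolvent_in_adjoint[OF S0 spec'(2)] adjoint_scaleC[OF dot]]])
  also have "\<dots> = b - b0 - s *\<^sub>R b1"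
    unfolding b_def b0_def b1_def
    by (simp add: scaleR_scaleC trace_scaleC[OF dot]
        trace_add[OF resolvent_in_adjoint[OF S0 spec'(2)] adjoint_scaleC[OF dot]])
  finally have "norm (b - b0 - s *\<^sub>R b1) = norm (T r1)"
    by simp
  also have "\<dots> \<le> L * norm r1"
    unfolding r1_def L
    by (rule norm_trace_kernel_le[OF first_remainder_in_kernel(1)[OF S0 spec'(2) Q1 S spec'(1)] ctx'(3)])
  also have "\<dots> \<le> L * (E * s\<^sup>2 * norm g)"
    unfolding r1_def E L
    by (intro mult_left_mono first_remainder_le[OF S S0 Q1 ctx'(1,2) M(3) ctx'(3) C c])
      (use L0 in \<open>simp add: L\<close>)
  finally have bbb: "norm (b - b0 - s *\<^sub>R b1) \<le> L * E * s\<^sup>2 * norm g"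
    by (simp add: mult_ac)
  let ?\<rho> = "\<lambda>x. P x - (P0 x + s *\<^sub>R Q1 x + (s\<^sup>2 / 2) *\<^sub>R Q2 x)"
  have "cinner ?r g = cinner (P a - P0 a) b - of_real s * cinner (Q1 a) b0
      - of_real (s\<^sup>2 / 2) * (cinner (Q2 a) b0 + 2 * cinner (Q1 a) b1)"
    using Krein_formula[OF S spec(1) S0 spec(2), of f g]
    by (simp add: cinner_simps cinner_resolvent_dot[OF S0 spec(2) Q1]
        cinner_resolvent_ddot[OF S0 spec(2) Q1 Q2] a_def b_def b0_def b1_def algebra_simps)
  also have "\<dots> = cinner (?\<rho> a) b + of_real s * cinner (Q1 a) (b - b0 - s *\<^sub>R b1)
      + of_real (s\<^sup>2 / 2) * cinner (Q2 a) (b - b0)"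
    by (simp add: cinner_simps field_simps power2_eq_square)
  also have "cmod \<dots> \<le> cmod (cinner (?\<rho> a) b) + \<bar>s\<bar> * cmod (cinner (Q1 a) (b - b0 - s *\<^sub>R b1))
      + s\<^sup>2 / 2 * cmod (cinner (Q2 a) (b - b0))"
    by (intro order_trans[OF norm_triangle_ineq] add_mono) (simp_all add: norm_mult norm_divide norm_power)
  also have "\<dots> \<le> (e * s\<^sup>2) * C * C * norm f * norm g
      + \<bar>s\<bar> * (c * C * (L * E * s\<^sup>2) * norm f * norm g)
      + s\<^sup>2 / 2 * (c * C * (L * c * C\<^sup>2 * \<bar>s\<bar>) * norm f * norm g)"
    unfolding a_def
    by (intro add_mono mult_left_mono cinner_le_product[OF ctx]
        norm_compose_sympl_J_trace_le[OF ctx, where L = ?\<rho>]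
        norm_compose_sympl_J_trace_le[OF ctx, where L = Q1]
        norm_compose_sympl_J_trace_le[OF ctx, where L = Q2] bb bbb c c2 e)
      (simp_all add: c e b_def trace_resolvent_bounds[OF ctx])
  also have "\<dots> = (e * C\<^sup>2 + \<bar>s\<bar> * (c * C * L * E + c\<^sup>2 * C ^ 3 * L / 2)) * s\<^sup>2 * norm f * norm g"
    by (simp add: power2_eq_square power3_eq_cube algebra_simps)
  also have "\<dots> \<le> (e * C\<^sup>2 + \<bar>s\<bar> * (c * C * L * E + c\<^sup>2 * C ^ 3 * L)) * s\<^sup>2 * norm f * norm g"
  proof -
    have "c\<^sup>2 * C ^ 3 * L / 2 \<le> c\<^sup>2 * C ^ 3 * L"
      using nn c L0 by simp
    then show ?thesis
      by (intro mult_right_mono add_left_mono mult_left_mono) auto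
  qed
  finally show "cmod (cinner ?r g) \<le>
      (e * C\<^sup>2 + \<bar>s\<bar> * (c * C * L * E + c\<^sup>2 * C ^ 3 * L)) * s\<^sup>2 * norm f * norm g" .
qed

end

lemma hplus_onorm_le:
  assumes "0 \<le> b" "\<And>f. hplus_norm A (F f) \<le> b * norm f"
  shows "hplus_onorm A F \<le> b"
  unfolding hplus_onorm_def
proof (rule cSUP_least)
  show "hplus_norm A (F f) / norm f \<le> b" for f
    using assms by (cases "f = 0") (simp_all add: pos_divide_le_eq)
qed simp

theorem theorem2p5:
  fixes A :: "('h::complex_hilbert \<times> 'h) set"
    and \<Gamma>0 \<Gamma>1 :: "'h \<Rightarrow> 'k::complex_hilbert"
    and Q :: "real \<Rightarrow> 'k \<times> 'k \<Rightarrow> 'k \<times> 'k"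
    and Qdot Qddot :: "'k \<times> 'k \<Rightarrow> 'k \<times> 'k"
    and At :: "real \<Rightarrow> ('h \<times> 'h) set"
    and t0 :: real and \<zeta>0 :: complex
    and T :: "'h \<Rightarrow> 'k \<times> 'k"
    and R :: "real \<Rightarrow> complex \<Rightarrow> 'h \<Rightarrow> 'h"
    and Rdot Rddot :: "complex \<Rightarrow> 'h \<Rightarrow> 'h"
    and U :: "real \<Rightarrow> (real \<times> complex) set"
  defines "T \<equiv> trace_map \<Gamma>0 \<Gamma>1"
    and "R \<equiv> \<lambda>t \<zeta>. resolvent (At t) \<zeta>"
    and "Rdot \<equiv> resolvent_dot T (At t0) Qdot"
    and "Rddot \<equiv> resolvent_ddot T (At t0) Qdot Qddot"
    and "U \<equiv> \<lambda>\<epsilon>. {(t, \<zeta>). t \<in> {0..1} \<and> \<bar>t - t0\<bar> \<le> \<epsilon> \<and> cmod (\<zeta> - \<zeta>0) \<le> \<epsilon>}"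
  assumes A: "densely_defined A" "symmetric_op A" "equal_deficiency_indices A"
    and triplet: "boundary_triplet A \<Gamma>0 \<Gamma>1"
    and Q: "\<And>t. t \<in> {0..1} \<Longrightarrow> orthogonal_projection (Q t) \<and> lagrangian (range (Q t))"
    and t0: "t0 \<in> {0..1}"
    and Qdot: "bounded_clinear Qdot" and Qddot: "bounded_clinear Qddot"
    and expansion:
      "(\<lambda>t. onorm (\<lambda>x. Q t x
              - (Q t0 x + (t - t0) *\<^sub>R Qdot x + ((t - t0)\<^sup>2 / 2) *\<^sub>R Qddot x)))
         \<in> o[at t0 within {0..1}](\<lambda>t. (t - t0)\<^sup>2)"
    and At: "\<And>t. t \<in> {0..1} \<Longrightarrow>
               self_adjoint_op (At t) \<and> A \<subseteq> At t \<and> T ` Domain (At t) = range (Q t)"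
    and \<zeta>0: "\<zeta>0 \<notin> Spec (At t0)"
  shows "(\<exists>\<epsilon>>0. \<forall>(t, \<zeta>)\<in>U \<epsilon>. \<zeta> \<notin> Spec (At t)) \<and>
    (\<forall>\<epsilon>>0. (\<forall>(t, \<zeta>)\<in>U \<epsilon>. \<zeta> \<notin> Spec (At t)) \<longrightarrow>
       (\<forall>(t, \<zeta>)\<in>U \<epsilon>. \<forall>\<zeta>'\<in>{\<zeta>, cnj \<zeta>}.
          bounded_into_hplus A (\<lambda>f.
            hilbert_adjoint (\<lambda>g. T (R t \<zeta>' g))
              (Q t (sympl_J (Q t0 (T (R t0 \<zeta> f)))) - Q t0 (sympl_J (Q t0 (T (R t0 \<zeta> f))))))) \<and>
       (\<forall>\<zeta>\<in>cball \<zeta>0 \<epsilon>.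
          bounded_into_hplus A (\<lambda>f.
            hilbert_adjoint (\<lambda>g. T (R t0 \<zeta> g)) (Qdot (sympl_J (T (R t0 \<zeta> f)))))) \<and>
       (\<forall>\<zeta>\<in>cball \<zeta>0 \<epsilon>. bounded_into_hplus A (Rdot \<zeta>)) \<and>
       (\<forall>e>0. \<forall>\<^sub>F t in at t0 within {0..1}. \<forall>\<zeta>\<in>ball \<zeta>0 \<epsilon>.
          bounded_into_hplus A (\<lambda>f. R t \<zeta> f - (R t0 \<zeta> f + (t - t0) *\<^sub>R Rdot \<zeta> f)) \<and>
          hplus_onorm A (\<lambda>f. R t \<zeta> f - (R t0 \<zeta> f + (t - t0) *\<^sub>R Rdot \<zeta> f)) \<le> e * \<bar>t - t0\<bar>) \<and>
       (\<forall>e>0. \<forall>\<^sub>F t in at t0 within {0..1}. \<forall>\<zeta>\<in>ball \<zeta>0 \<epsilon>.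
          bounded_clinear (\<lambda>f. R t \<zeta> f
            - (R t0 \<zeta> f + (t - t0) *\<^sub>R Rdot \<zeta> f + ((t - t0)\<^sup>2 / 2) *\<^sub>R Rddot \<zeta> f)) \<and>
          onorm (\<lambda>f. R t \<zeta> f
            - (R t0 \<zeta> f + (t - t0) *\<^sub>R Rdot \<zeta> f + ((t - t0)\<^sup>2 / 2) *\<^sub>R Rddot \<zeta> f))
            \<le> e * (t - t0)\<^sup>2))"
proof -
  obtain K' where K': "\<And>u. u \<in> hplus A \<Longrightarrow> norm (trace_map \<Gamma>0 \<Gamma>1 u) \<le> K' * hplus_norm A u"
    using triplet unfolding boundary_triplet_def by blast
  \<comment> \<open>\<open>K'\<close> may be negative when the domain of the adjoint is \<open>{0}\<close>.\<close>
  define K where "K = max K' 0"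
  interpret boundary_trace A \<Gamma>0 \<Gamma>1 K
  proof
    show "norm (trace_map \<Gamma>0 \<Gamma>1 u) \<le> K * hplus_norm A u" if "u \<in> hplus A" for u
    proof -
      have "0 \<le> hplus_norm A u"
        by (simp add: hplus_norm_def hplus_cinner_def cinner_self)
      then have "K' * hplus_norm A u \<le> K * hplus_norm A u"
        by (intro mult_right_mono) (simp_all add: K_def)
      then show ?thesis
        using K'[OF that] by simp
    qed
  qed (use A triplet in \<open>simp_all add: K_def\<close>)
  have ext: "lagrangian_extension (trace_map \<Gamma>0 \<Gamma>1) A (Q t) (At t)" if "t \<in> {0..1}" for t
    using Q[OF that] At[OF that] by (simp add: lagrangian_extension_def T_def)
  have sa: "self_adjoint_op (At t)" if "t \<in> {0..1}" for t
    using At[OF that] by blast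
  have Qb: "bounded_clinear (Q t)" if "t \<in> {0..1}" for t
    using Q[OF that] by (simp add: orthogonal_projection_def)
  let ?F = "at t0 within {0..1}"

  have Q_second: "\<forall>\<^sub>F t in ?F. t \<in> {0..1} \<and> (\<forall>x.
      norm (Q t x - (Q t0 x + (t - t0) *\<^sub>R Qdot x + ((t - t0)\<^sup>2 / 2) *\<^sub>R Qddot x)) \<le> e * (t - t0)\<^sup>2 * norm x)"
    if "e > 0" for e
  proof -
    have "\<forall>\<^sub>F t in ?F. t \<in> {0..1}"
      by (auto simp: eventually_at intro: exI[of _ 1])
    with landau_o.smallD[OF expansion that] show ?thesis
    proof eventually_elim
      case (elim t)
      let ?\<rho> = "\<lambda>x. Q t x - (Q t0 x + (t - t0) *\<^sub>R Qdot x + ((t - t0)\<^sup>2 / 2) *\<^sub>R Qddot x)"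
      have "bounded_clinear ?\<rho>"
        by (intro bounded_clinear_minus bounded_clinear_plus bounded_clinear_scaleR_fun Qb Qdot Qddot t0 elim)
      then have "norm (?\<rho> x) \<le> onorm ?\<rho> * norm x" for x
        unfolding bounded_clinear_def by (intro onorm) blast
      moreover have "onorm ?\<rho> * norm x \<le> e * (t - t0)\<^sup>2 * norm x" for x
        using elim(1) by (intro mult_right_mono) auto
      ultimately show ?case
        using elim(2) order_trans by blast
    qed
  qed
  obtain q1 q2 where q: "0 \<le> q1" "\<And>x. norm (Qdot x) \<le> q1 * norm x" "0 \<le> q2" "\<And>x. norm (Qddot x) \<le> q2 * norm x"
    using bounded_clinear_bound[OF Qdot] bounded_clinear_bound[OF Qddot] by metis
  define c where "c = 1 + q1 + q2"
  have c0: "0 < c" "0 \<le> c"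
    using q by (simp_all add: c_def)
  have c: "norm (Qdot x) \<le> c * norm x" "norm (Qddot x) \<le> c * norm x" for x
  proof -
    have "q1 * norm x \<le> c * norm x" "q2 * norm x \<le> c * norm x"
      using q by (auto intro!: mult_right_mono simp: c_def)
    then show "norm (Qdot x) \<le> c * norm x" "norm (Qddot x) \<le> c * norm x"
      using q(2,4)[of x] by simp_all
  qed
  have close: "\<forall>\<^sub>F t in ?F. \<bar>t - t0\<bar> < d" if "d > 0" for d
    using that by (auto simp: eventually_at dist_norm)
  have Q_first: "\<forall>\<^sub>F t in ?F. t \<in> {0..1} \<and>
      (\<forall>x. norm (Q t x - Q t0 x) \<le> c * \<bar>t - t0\<bar> * norm x) \<and>
      (\<forall>x. norm (Q t x - (Q t0 x + (t - t0) *\<^sub>R Qdot x)) \<le> c * (t - t0)\<^sup>2 * norm x)"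
    using Q_second[of 1, OF zero_less_one] close[of 1, OF zero_less_one]
  proof eventually_elim
    case (elim t)
    have one: "norm (Q t x - (Q t0 x + (t - t0) *\<^sub>R Qdot x)) \<le> (1 + q2) * (t - t0)\<^sup>2 * norm x" for x
    proof -
      have "Q t x - (Q t0 x + (t - t0) *\<^sub>R Qdot x) =
          (Q t x - (Q t0 x + (t - t0) *\<^sub>R Qdot x + ((t - t0)\<^sup>2 / 2) *\<^sub>R Qddot x)) + ((t - t0)\<^sup>2 / 2) *\<^sub>R Qddot x"
        by simp
      also have "norm \<dots> \<le> 1 * (t - t0)\<^sup>2 * norm x + (t - t0)\<^sup>2 / 2 * (q2 * norm x)"
        using conjunct2[OF elim(1), rule_format, of x] q(4)[of x]
        by (intro norm_triangle_mono) (auto intro!: mult_left_mono)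
      also have "\<dots> \<le> (1 + q2) * (t - t0)\<^sup>2 * norm x"
        using mult_nonneg_nonneg[OF mult_nonneg_nonneg[OF q(3) zero_le_power2[of "t - t0"]] norm_ge_zero[of x]]
        by (simp add: algebra_simps)
      finally show ?thesis .
    qed
    have "(1 + q2) * (t - t0)\<^sup>2 * norm x \<le> c * (t - t0)\<^sup>2 * norm x" for x
      using q by (intro mult_right_mono) (auto simp: c_def)
    then have two: "norm (Q t x - (Q t0 x + (t - t0) *\<^sub>R Qdot x)) \<le> c * (t - t0)\<^sup>2 * norm x" for x
      using one[of x] order_trans by blast
    have "(t - t0)\<^sup>2 \<le> \<bar>t - t0\<bar>"
      using elim(2) mult_right_mono[of "\<bar>t - t0\<bar>" 1 "\<bar>t - t0\<bar>"] by (simp add: power2_eq_square flip: abs_mult)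
    have three: "norm (Q t x - Q t0 x) \<le> c * \<bar>t - t0\<bar> * norm x" for x
    proof -
      have "Q t x - Q t0 x = (Q t x - (Q t0 x + (t - t0) *\<^sub>R Qdot x)) + (t - t0) *\<^sub>R Qdot x"
        by simp
      also have "norm \<dots> \<le> (1 + q2) * (t - t0)\<^sup>2 * norm x + \<bar>t - t0\<bar> * (q1 * norm x)"
        using one[of x] q(2)[of x] by (intro norm_triangle_mono) (auto intro!: mult_left_mono)
      also have "\<dots> \<le> (1 + q2) * \<bar>t - t0\<bar> * norm x + \<bar>t - t0\<bar> * (q1 * norm x)"
        using \<open>(t - t0)\<^sup>2 \<le> \<bar>t - t0\<bar>\<close> q by (intro add_right_mono mult_right_mono mult_left_mono) auto
      also have "\<dots> = c * \<bar>t - t0\<bar> * norm x"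
        by (simp add: c_def algebra_simps)
      finally show ?thesis .
    qed
    show ?case
      using elim(1) two three by blast
  qed

  have near: "\<forall>\<^sub>F t in ?F. t \<in> {0..1} \<and> (\<forall>\<zeta>\<in>Y. bounded_below_at (At t) \<zeta> (2 * M + 1))"
    if Y: "\<And>\<zeta>. \<zeta> \<in> Y \<Longrightarrow> bounded_below_at (At t0) \<zeta> M \<and> cmod \<zeta> \<le> Z" and M: "0 \<le> M" and Z: "0 \<le> Z"
    for Y M Z
  proof -
    define X where "X = K * (1 + (1 + Z) * M) * K * (1 + Z)"
    have X: "0 \<le> X"
      using K_nonneg M Z by (simp add: X_def)
    \<comment> \<open>\<open>d\<close> is such that the gap \<open>c * \<bar>t - t0\<bar>\<close> of the projections satisfies the smallness
      condition of the transfer of lower bounds; \<open>X\<close> collects its constants and may be \<open>0\<close>.\<close>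
    define d where "d = 1 / (2 * c * (X + 1))"
    have "d > 0"
      using c0 X by (simp add: d_def)
    from Q_first close[OF this] show ?thesis
    proof eventually_elim
      case (elim t)
      have "c * \<bar>t - t0\<bar> * X \<le> c * d * (X + 1)"
        using elim(2) X c0 by (intro mult_mono) auto
      also have "\<dots> = 1 / 2"
        using c0 X by (simp add: d_def field_simps add_nonneg_eq_0_iff)
      finally have "c * \<bar>t - t0\<bar> * (K * (1 + (1 + Z) * M)) * K * (1 + Z) \<le> 1 / 2"
        by (simp add: X_def mult_ac)
      then show ?case
        using elim(1) Y M c0
        by (auto intro!: bounded_below_at_near_extension[OF ext[of t] ext[OF t0], where Z = Z])
    qed
  qed

  have part1: "\<exists>\<epsilon>>0. \<forall>(t, \<zeta>)\<in>U \<epsilon>. \<zeta> \<notin> Spec (At t)"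
  proof -
    obtain M where M: "0 \<le> M" "bounded_below_at (At t0) \<zeta>0 M"
      using not_Spec_iff_bounded_below[OF sa[OF t0]] \<zeta>0 by blast
    define \<epsilon>1 where "\<epsilon>1 = 1 / (2 * (M + 1))"
    have \<epsilon>1: "\<epsilon>1 > 0" "M * \<epsilon>1 \<le> 1 / 2"
      using M by (simp_all add: \<epsilon>1_def field_simps)
    have below: "bounded_below_at (At t0) \<zeta> (2 * M)" if "\<zeta> \<in> cball \<zeta>0 \<epsilon>1" for \<zeta>
    proof (rule bounded_below_at_perturb[OF M(2,1)])
      have "M * cmod (\<zeta> - \<zeta>0) \<le> M * \<epsilon>1"
        using that M by (intro mult_left_mono) (auto simp: dist_norm norm_minus_commute)
      then show "M * cmod (\<zeta> - \<zeta>0) \<le> 1 / 2"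
        using \<epsilon>1 by simp
    qed
    have norm: "cmod \<zeta> \<le> cmod \<zeta>0 + \<epsilon>1" if "\<zeta> \<in> cball \<zeta>0 \<epsilon>1" for \<zeta>
      using that norm_triangle_ineq2[of \<zeta> \<zeta>0] by (simp add: dist_norm norm_minus_commute)
    have "\<forall>\<^sub>F t in ?F. t \<in> {0..1} \<and> (\<forall>\<zeta>\<in>cball \<zeta>0 \<epsilon>1. bounded_below_at (At t) \<zeta> (2 * (2 * M) + 1))"
      by (rule near[where Z = "cmod \<zeta>0 + \<epsilon>1"]) (use below norm M \<epsilon>1 in \<open>auto simp: add_nonneg_nonneg\<close>)
    then obtain d where d: "d > 0" "\<And>t \<zeta>. t \<in> {0..1} \<Longrightarrow> t \<noteq> t0 \<Longrightarrow> dist t t0 < d \<Longrightarrow> \<zeta> \<in> cball \<zeta>0 \<epsilon>1 \<Longrightarrow>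
        bounded_below_at (At t) \<zeta> (2 * (2 * M) + 1)"
      unfolding eventually_at by blast
    \<comment> \<open>The filter at \<open>t0\<close> omits \<open>t0\<close> itself, where the bound \<open>2 * M\<close> applies directly.\<close>
    have "\<zeta> \<notin> Spec (At t)" if "(t, \<zeta>) \<in> U (min \<epsilon>1 (d / 2))" for t \<zeta>
    proof -
      have t: "t \<in> {0..1}" "dist t t0 < d" and \<zeta>: "\<zeta> \<in> cball \<zeta>0 \<epsilon>1"
        using that d(1) by (auto simp: U_def dist_norm norm_minus_commute)
      have "\<exists>M\<ge>0. bounded_below_at (At t) \<zeta> M"
      proof (cases "t = t0")
        case True
        then show ?thesis
          using below[OF \<zeta>] M by (auto intro!: exI[of _ "2 * M"])
      next
        case False
        then show ?thesis
          using d(2)[OF t(1) False t(2) \<zeta>] M by (auto intro!: exI[of _ "2 * (2 * M) + 1"])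
      qed
      then show ?thesis
        using not_Spec_iff_bounded_below[OF sa[OF t(1)]] by blast
    qed
    then show ?thesis
      using \<epsilon>1 d(1) by (intro exI[of _ "min \<epsilon>1 (d / 2)"]) auto
  qed

  have parts: "(\<forall>(t, \<zeta>)\<in>U \<epsilon>. \<forall>\<zeta>'\<in>{\<zeta>, cnj \<zeta>}.
          bounded_into_hplus A (\<lambda>f.
            hilbert_adjoint (\<lambda>g. T (R t \<zeta>' g))
              (Q t (sympl_J (Q t0 (T (R t0 \<zeta> f)))) - Q t0 (sympl_J (Q t0 (T (R t0 \<zeta> f))))))) \<and>
       (\<forall>\<zeta>\<in>cball \<zeta>0 \<epsilon>.
          bounded_into_hplus A (\<lambda>f.
            hilbert_adjoint (\<lambda>g. T (R t0 \<zeta> g)) (Qdot (sympl_J (T (R t0 \<zeta> f)))))) \<and>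
       (\<forall>\<zeta>\<in>cball \<zeta>0 \<epsilon>. bounded_into_hplus A (Rdot \<zeta>)) \<and>
       (\<forall>e>0. \<forall>\<^sub>F t in at t0 within {0..1}. \<forall>\<zeta>\<in>ball \<zeta>0 \<epsilon>.
          bounded_into_hplus A (\<lambda>f. R t \<zeta> f - (R t0 \<zeta> f + (t - t0) *\<^sub>R Rdot \<zeta> f)) \<and>
          hplus_onorm A (\<lambda>f. R t \<zeta> f - (R t0 \<zeta> f + (t - t0) *\<^sub>R Rdot \<zeta> f)) \<le> e * \<bar>t - t0\<bar>) \<and>
       (\<forall>e>0. \<forall>\<^sub>F t in at t0 within {0..1}. \<forall>\<zeta>\<in>ball \<zeta>0 \<epsilon>.
          bounded_clinear (\<lambda>f. R t \<zeta> f
            - (R t0 \<zeta> f + (t - t0) *\<^sub>R Rdot \<zeta> f + ((t - t0)\<^sup>2 / 2) *\<^sub>R Rddot \<zeta> f)) \<and>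
          onorm (\<lambda>f. R t \<zeta> f
            - (R t0 \<zeta> f + (t - t0) *\<^sub>R Rdot \<zeta> f + ((t - t0)\<^sup>2 / 2) *\<^sub>R Rddot \<zeta> f))
            \<le> e * (t - t0)\<^sup>2)"
    if \<epsilon>: "\<epsilon> > 0" and spec: "\<forall>(t, \<zeta>)\<in>U \<epsilon>. \<zeta> \<notin> Spec (At t)" for \<epsilon>
  proof -
    have spec0: "\<zeta> \<notin> Spec (At t0)" if "\<zeta> \<in> cball \<zeta>0 \<epsilon>" for \<zeta>
    proof -
      have "(t0, \<zeta>) \<in> U \<epsilon>"
        using that t0 \<epsilon> by (simp add: U_def dist_norm norm_minus_commute)
      then show ?thesis
        using spec by blast
    qed
    obtain M0 where M0: "0 \<le> M0" "\<And>\<zeta>. \<zeta> \<in> cball \<zeta>0 \<epsilon> \<Longrightarrow> bounded_below_at (At t0) \<zeta> M0"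
      using bounded_below_on_compact[OF sa[OF t0] compact_cball spec0] by blast
    \<comment> \<open>The transfer of lower bounds turns \<open>M0\<close> into \<open>M\<close> for all \<open>t\<close> near \<open>t0\<close>; \<open>C\<close> then bounds the
      traces of the resolvents, \<open>L\<close> the trace on the kernels, and \<open>E\<close> the first order remainder.\<close>
    define M where "M = 2 * M0 + 1"
    define Z where "Z = cmod \<zeta>0 + \<epsilon>"
    define C where "C = K * (1 + (1 + Z) * M)"
    define L where "L = K * (1 + Z)"
    define E where "E = c * C\<^sup>2 + c\<^sup>2 * C ^ 3 * L"
    have M: "0 \<le> M" "\<And>\<zeta>. \<zeta> \<in> cball \<zeta>0 \<epsilon> \<Longrightarrow> bounded_below_at (At t0) \<zeta> M"
      using M0 bounded_below_at_mono[of "At t0" _ M0 M] by (simp_all add: M_def)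
    have Z: "0 \<le> Z" "\<And>\<zeta>. \<zeta> \<in> cball \<zeta>0 \<epsilon> \<Longrightarrow> cmod \<zeta> \<le> Z"
    proof -
      show "0 \<le> Z"
        using \<epsilon> by (simp add: Z_def)
      show "cmod \<zeta> \<le> Z" if "\<zeta> \<in> cball \<zeta>0 \<epsilon>" for \<zeta>
        using that norm_triangle_ineq2[of \<zeta> \<zeta>0] by (simp add: Z_def dist_norm norm_minus_commute)
    qed
    have nonneg: "0 \<le> C" "0 \<le> L" "0 \<le> E"
      using K_nonneg M Z c0 by (simp_all add: C_def L_def E_def)
    have near': "\<forall>\<^sub>F t in ?F. t \<in> {0..1} \<and> (\<forall>\<zeta>\<in>cball \<zeta>0 \<epsilon>. bounded_below_at (At t) \<zeta> M)"
      unfolding M_def by (rule near[where Z = Z]) (use M0 Z in auto)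

    have two: "\<forall>(t, \<zeta>)\<in>U \<epsilon>. \<forall>\<zeta>'\<in>{\<zeta>, cnj \<zeta>}.
          bounded_into_hplus A (\<lambda>f.
            hilbert_adjoint (\<lambda>g. T (R t \<zeta>' g))
              (Q t (sympl_J (Q t0 (T (R t0 \<zeta> f)))) - Q t0 (sympl_J (Q t0 (T (R t0 \<zeta> f))))))"
    proof clarify
      fix t \<zeta> \<zeta>' assume t\<zeta>: "(t, \<zeta>) \<in> U \<epsilon>" and \<zeta>': "\<zeta>' \<in> {\<zeta>, cnj \<zeta>}"
      have t: "t \<in> {0..1}" and \<zeta>: "\<zeta> \<in> cball \<zeta>0 \<epsilon>"
        using t\<zeta> by (auto simp: U_def dist_norm norm_minus_commute)
      have "\<zeta>' \<notin> Spec (At t)"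
        using spec t\<zeta> \<zeta>' cnj_not_Spec[OF sa[OF t]] by auto
      then show "bounded_into_hplus A (\<lambda>f.
            hilbert_adjoint (\<lambda>g. T (R t \<zeta>' g))
              (Q t (sympl_J (Q t0 (T (R t0 \<zeta> f)))) - Q t0 (sympl_J (Q t0 (T (R t0 \<zeta> f))))))"
        unfolding R_def T_def
        by (intro adjoint_trace_resolvent_into_hplus[OF ext[OF t]] bounded_clinear_minus
            bounded_clinear_compose[OF Qb[OF t]] bounded_clinear_compose[OF Qb[OF t0]]
            bounded_clinear_compose[OF bounded_clinear_sympl_J]
            trace_resolvent_bounded_clinear[OF ext[OF t0] spec0[OF \<zeta>]])
    qed
    have three: "\<forall>\<zeta>\<in>cball \<zeta>0 \<epsilon>.
          bounded_into_hplus A (\<lambda>f.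
            hilbert_adjoint (\<lambda>g. T (R t0 \<zeta> g)) (Qdot (sympl_J (T (R t0 \<zeta> f)))))"
      unfolding R_def T_def
      by (intro ballI adjoint_trace_resolvent_into_hplus[OF ext[OF t0]]
          bounded_clinear_compose[OF Qdot] bounded_clinear_sympl_J_trace[OF ext[OF t0]] spec0)
    have four: "\<forall>\<zeta>\<in>cball \<zeta>0 \<epsilon>. bounded_into_hplus A (Rdot \<zeta>)"
      unfolding Rdot_def T_def by (intro ballI resolvent_dot_into_hplus[OF ext[OF t0]] spec0 Qdot)
    have five: "\<forall>\<^sub>F t in ?F. \<forall>\<zeta>\<in>ball \<zeta>0 \<epsilon>.
          bounded_into_hplus A (\<lambda>f. R t \<zeta> f - (R t0 \<zeta> f + (t - t0) *\<^sub>R Rdot \<zeta> f)) \<and>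
          hplus_onorm A (\<lambda>f. R t \<zeta> f - (R t0 \<zeta> f + (t - t0) *\<^sub>R Rdot \<zeta> f)) \<le> e * \<bar>t - t0\<bar>"
      if e: "e > 0" for e
    proof -
      define d where "d = e / ((1 + Z) * E + 1)"
      have pos: "0 < (1 + Z) * E + 1"
        using Z nonneg by (simp add: add_nonneg_pos)
      have "d > 0"
        using e pos by (simp add: d_def)
      from near' Q_first close[OF this] show ?thesis
      proof (eventually_elim, intro ballI)
        fix t \<zeta> assume near_t: "t \<in> {0..1} \<and> (\<forall>\<zeta>\<in>cball \<zeta>0 \<epsilon>. bounded_below_at (At t) \<zeta> M)"
          and Qt: "t \<in> {0..1} \<and>
            (\<forall>x. norm (Q t x - Q t0 x) \<le> c * \<bar>t - t0\<bar> * norm x) \<and>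
            (\<forall>x. norm (Q t x - (Q t0 x + (t - t0) *\<^sub>R Qdot x)) \<le> c * (t - t0)\<^sup>2 * norm x)"
          and d: "\<bar>t - t0\<bar> < d" and "\<zeta> \<in> ball \<zeta>0 \<epsilon>"
        then have t: "t \<in> {0..1}" and \<zeta>: "\<zeta> \<in> cball \<zeta>0 \<epsilon>" and Mt: "bounded_below_at (At t) \<zeta> M"
          by auto
        have spec_t: "\<zeta> \<notin> Spec (At t)"
          using not_Spec_iff_bounded_below[OF sa[OF t]] Mt M(1) by blast
        let ?r = "\<lambda>f. R t \<zeta> f - (R t0 \<zeta> f + (t - t0) *\<^sub>R Rdot \<zeta> f)"
        have ker: "(?r f, \<zeta> *\<^sub>C ?r f) \<in> op_adjoint A" and lin: "bounded_clinear ?r" for f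
          unfolding R_def Rdot_def T_def
          using first_remainder_in_kernel[OF ext[OF t0] spec0[OF \<zeta>] Qdot ext[OF t] spec_t] by blast+
        have "norm (?r f) \<le> E * (t - t0)\<^sup>2 * norm f" for f
          unfolding R_def Rdot_def T_def E_def L_def
          using Qt by (intro first_remainder_le[OF ext[OF t] ext[OF t0] Qdot Mt M(2)[OF \<zeta>] M(1) Z(2)[OF \<zeta>] C_def c0(2) c(1)]) auto
        then have "(1 + Z) * norm (?r f) \<le> (1 + Z) * (E * (t - t0)\<^sup>2 * norm f)" for f
          using Z(1) by (intro mult_left_mono) auto
        moreover have "(1 + Z) * (E * (t - t0)\<^sup>2 * norm f) \<le> e * \<bar>t - t0\<bar> * norm f" for f
        proof -
          have "(1 + Z) * E * \<bar>t - t0\<bar> \<le> ((1 + Z) * E + 1) * d"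
            using d Z nonneg by (intro mult_mono) auto
          also have "\<dots> = e"
            using pos by (simp add: d_def)
          finally have "((1 + Z) * E * \<bar>t - t0\<bar>) * (\<bar>t - t0\<bar> * norm f) \<le> e * (\<bar>t - t0\<bar> * norm f)"
            by (rule mult_right_mono) simp
          then show ?thesis
            by (simp add: power2_eq_square mult_ac flip: abs_mult)
        qed
        ultimately have "hplus_norm A (?r f) \<le> e * \<bar>t - t0\<bar> * norm f" for f
          using hplus_norm_kernel_le[OF ker[of f] Z(2)[OF \<zeta>]] by (meson order_trans)
        then show "bounded_into_hplus A ?r \<and> hplus_onorm A ?r \<le> e * \<bar>t - t0\<bar>"
          using e by (intro conjI bounded_into_hplusI[OF lin bounded_clinear_scaleC_fun[OF lin] ker] hplus_onorm_le) auto
      qed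
    qed
    have six: "\<forall>\<^sub>F t in ?F. \<forall>\<zeta>\<in>ball \<zeta>0 \<epsilon>.
          bounded_clinear (\<lambda>f. R t \<zeta> f
            - (R t0 \<zeta> f + (t - t0) *\<^sub>R Rdot \<zeta> f + ((t - t0)\<^sup>2 / 2) *\<^sub>R Rddot \<zeta> f)) \<and>
          onorm (\<lambda>f. R t \<zeta> f
            - (R t0 \<zeta> f + (t - t0) *\<^sub>R Rdot \<zeta> f + ((t - t0)\<^sup>2 / 2) *\<^sub>R Rddot \<zeta> f))
            \<le> e * (t - t0)\<^sup>2"
      if e: "e > 0" for e
    proof -
      define W where "W = C\<^sup>2 + 1"
      \<comment> \<open>Half of \<open>e\<close> pays for the remainder of the projections, half for the terms of order
        \<open>\<bar>t - t0\<bar> ^ 3\<close>.\<close>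
      define e1 where "e1 = e / (2 * W)"
      define N where "N = c * C * L * E + c\<^sup>2 * C ^ 3 * L"
      define V where "V = N + 1"
      define d where "d = e / (2 * V)"
      have N: "0 \<le> N"
        using nonneg c0 by (simp add: N_def)
      then have V: "0 < V" "N \<le> V"
        by (simp_all add: V_def)
      have W: "0 < W" "C\<^sup>2 \<le> W"
        by (simp_all add: W_def add_nonneg_pos)
      have e1: "e1 > 0"
        using e W by (simp add: e1_def)
      have "d > 0"
        using e V by (simp add: d_def)
      from near' Q_first Q_second[OF e1] close[OF this] show ?thesis
      proof (eventually_elim, intro ballI)
        fix t \<zeta> assume near_t: "t \<in> {0..1} \<and> (\<forall>\<zeta>\<in>cball \<zeta>0 \<epsilon>. bounded_below_at (At t) \<zeta> M)"
          and Qt: "t \<in> {0..1} \<and>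
            (\<forall>x. norm (Q t x - Q t0 x) \<le> c * \<bar>t - t0\<bar> * norm x) \<and>
            (\<forall>x. norm (Q t x - (Q t0 x + (t - t0) *\<^sub>R Qdot x)) \<le> c * (t - t0)\<^sup>2 * norm x)"
          and Qt2: "t \<in> {0..1} \<and> (\<forall>x. norm (Q t x - (Q t0 x + (t - t0) *\<^sub>R Qdot x
            + ((t - t0)\<^sup>2 / 2) *\<^sub>R Qddot x)) \<le> e1 * (t - t0)\<^sup>2 * norm x)"
          and d: "\<bar>t - t0\<bar> < d" and "\<zeta> \<in> ball \<zeta>0 \<epsilon>"
        then have t: "t \<in> {0..1}" and \<zeta>: "\<zeta> \<in> cball \<zeta>0 \<epsilon>" and Mt: "bounded_below_at (At t) \<zeta> M"
          by auto
        have spec_t: "\<zeta> \<notin> Spec (At t)"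
          using not_Spec_iff_bounded_below[OF sa[OF t]] Mt M(1) by blast
        let ?r = "\<lambda>f. R t \<zeta> f - (R t0 \<zeta> f + (t - t0) *\<^sub>R Rdot \<zeta> f + ((t - t0)\<^sup>2 / 2) *\<^sub>R Rddot \<zeta> f)"
        have lin: "bounded_clinear ?r"
          unfolding R_def Rdot_def Rddot_def T_def
          by (intro bounded_clinear_minus bounded_clinear_plus bounded_clinear_scaleR_fun
              bounded_clinear_resolvent[OF spec_t] bounded_clinear_resolvent[OF spec0[OF \<zeta>]]
              bounded_clinear_resolvent_dot[OF ext[OF t0] spec0[OF \<zeta>] Qdot]
              bounded_clinear_resolvent_ddot[OF ext[OF t0] spec0[OF \<zeta>] Qdot Qddot])
        have "norm (?r f) \<le> (e1 * C\<^sup>2 + \<bar>t - t0\<bar> * N) * (t - t0)\<^sup>2 * norm f" for f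
          unfolding R_def Rdot_def Rddot_def T_def N_def
          using Qt Qt2 e1
          by (intro second_remainder_le[OF ext[OF t] ext[OF t0] Qdot Qddot Mt M(2)[OF \<zeta>] M(1)
                Z(2)[OF \<zeta>] C_def c0(2) c(1) _ _ c(2) _ _ L_def E_def]) auto
        moreover have "(e1 * C\<^sup>2 + \<bar>t - t0\<bar> * N) * (t - t0)\<^sup>2 * norm f \<le> e * (t - t0)\<^sup>2 * norm f" for f
        proof -
          have "e1 * C\<^sup>2 \<le> e1 * W"
            using e1 W by (intro mult_left_mono) auto
          also have "\<dots> = e / 2"
            using W by (simp add: e1_def)
          finally have "e1 * C\<^sup>2 \<le> e / 2" .
          moreover have "\<bar>t - t0\<bar> * N \<le> d * V"
            using d N V by (intro mult_mono) auto
          moreover have "d * V = e / 2"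
            using V by (simp add: d_def)
          ultimately have "e1 * C\<^sup>2 + \<bar>t - t0\<bar> * N \<le> e"
            by simp
          then show ?thesis
            by (intro mult_right_mono) auto
        qed
        ultimately have "norm (?r f) \<le> e * (t - t0)\<^sup>2 * norm f" for f
          by (meson order_trans)
        then show "bounded_clinear ?r \<and> onorm ?r \<le> e * (t - t0)\<^sup>2"
          using e lin by (auto intro!: onorm_bound)
      qed
    qed
    show ?thesis
      using two three four five six by blast
  qed
  show ?thesis
    using part1 parts by blast
qed

end
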